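(* Let $\mathscr{F}$ be an $\mathscr{L}$-foliation (of codimension one) of degree $\nu$ on $\mathbf{C}\mathbf{P}(n)$. Then $\nu\leq n-1$. Moreover, if $\nu=n-1$, then $\dim\mathscr{L}=n-1$.
   Context: A codimension one foliation $\mathscr{F}$ of degree $\nu$ on $\mathbf{C}\mathbf{P}(n)$ is given in homogeneous coordinates by a $1$-form $\omega=\sum_{k=0}^nA_kdz_k$ on $\mathbf{C}^{n+1}$, with $A_k$ homogeneous polynomials of degree $\nu+1$, $\omega\wedge d\omega=0$, $\sum z_kA_k=0$, and $\{A_0=\dots=A_n=0\}$ of codimension $\geq2$. Let $\chi(\mathbf{C}\mathbf{P}(n))$ be the Lie algebra of holomorphic vector fields on $\mathbf{C}\mathbf{P}(n)$. $\mathscr{F}$ is an $\mathscr{L}$-foliation if there is a Lie subalgebra $\mathscr{L}\subset\chi(\mathbf{C}\mathbf{P}(n))$ such that, for generic $z$, $\mathscr{L}(z)=\{X(z):X\in\mathscr{L}\}$ is the tangent space at $z$ to the leaf of $\mathscr{F}$ (so it has dimension $n-1$); $\mathscr{L}$ always denotes the maximal such subalgebra, i.e. the algebra of all holomorphic vector fields on $\mathbf{C}\mathbf{P}(n)$ tangent to $\mathscr{F}$. *)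

theory Defs
  imports "HOL-Analysis.Analysis" "HOL-Library.Function_Algebras" "HOL-Library.Extended_Nat"
begin

section \<open>Polynomial functions and algebraic subsets of affine space\<close>

text \<open>The type \<open>complex ^ 'n\<close> with \<open>CARD('n) = n + 1\<close> is the space carrying the homogeneous
  coordinates of the projective space of dimension \<open>n\<close>.\<close>

definition monomial_fun :: "('n::finite \<Rightarrow> nat) \<Rightarrow> complex ^ 'n \<Rightarrow> complex" where
  "monomial_fun a z = (\<Prod>k\<in>UNIV. (z $ k) ^ a k)"

definition poly_fun :: "(complex ^ 'n::finite \<Rightarrow> complex) \<Rightarrow> bool" where
  "poly_fun f \<longleftrightarrow> (\<exists>S c. finite S \<and> f = (\<lambda>z. \<Sum>a\<in>S. c a * monomial_fun a z))"

definition hom_poly_fun :: "nat \<Rightarrow> (complex ^ 'n::finite \<Rightarrow> complex) \<Rightarrow> bool" where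
  "hom_poly_fun d f \<longleftrightarrow>
     (\<exists>S c. finite S \<and> (\<forall>a\<in>S. (\<Sum>k\<in>UNIV. a k) = d) \<and>
            f = (\<lambda>z. \<Sum>a\<in>S. c a * monomial_fun a z))"

definition algebraic_set :: "(complex ^ 'n::finite) set \<Rightarrow> bool" where
  "algebraic_set S \<longleftrightarrow> (\<exists>F. (\<forall>f\<in>F. poly_fun f) \<and> S = {z. \<forall>f\<in>F. f z = 0})"

definition irreducible_alg_set :: "(complex ^ 'n::finite) set \<Rightarrow> bool" where
  "irreducible_alg_set Y \<longleftrightarrow> algebraic_set Y \<and> Y \<noteq> {} \<and>
     (\<forall>S T. algebraic_set S \<and> algebraic_set T \<and> Y \<subseteq> S \<union> T \<longrightarrow> Y \<subseteq> S \<or> Y \<subseteq> T)"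

text \<open>Krull codimension in the Zariski topology: for an irreducible set, the supremum of the
  lengths of chains of irreducible algebraic sets starting at it; in general, the infimum over the
  irreducible algebraic subsets (so the empty set has codimension \<open>\<infinity>\<close>).\<close>

definition irreducible_codim :: "(complex ^ 'n::finite) set \<Rightarrow> enat" where
  "irreducible_codim Y =
     Sup {enat m | m. \<exists>C. C 0 = Y \<and> (\<forall>j\<le>m. irreducible_alg_set (C j)) \<and> (\<forall>j<m. C j \<subset> C (Suc j))}"

definition codim :: "(complex ^ 'n::finite) set \<Rightarrow> enat" where
  "codim S = Inf {irreducible_codim Y | Y. irreducible_alg_set Y \<and> Y \<subseteq> S}"


section \<open>Differential forms and codimension one foliations\<close>

definition dir_deriv ::
    "(complex ^ 'n::finite \<Rightarrow> complex ^ 'n) \<Rightarrow> complex ^ 'n \<Rightarrow> complex ^ 'n \<Rightarrow> complex ^ 'n" where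
  "dir_deriv F z v = (\<chi> k. deriv (\<lambda>t. F (z + t *s v) $ k) 0)"

text \<open>\<open>one_form A\<close> is the form \<open>\<Sum>k. A\<^sub>k dz\<^sub>k\<close> with coefficients \<open>A\<^sub>k z = A z $ k\<close>.\<close>

definition one_form ::
    "(complex ^ 'n::finite \<Rightarrow> complex ^ 'n) \<Rightarrow> complex ^ 'n \<Rightarrow> complex ^ 'n \<Rightarrow> complex" where
  "one_form A z v = (\<Sum>k\<in>UNIV. A z $ k * v $ k)"

text \<open>\<open>\<Sum>k. dA\<^sub>k \<and> dz\<^sub>k\<close>, the exterior derivative of \<open>one_form A\<close>.\<close>

definition d_one_form ::
    "(complex ^ 'n::finite \<Rightarrow> complex ^ 'n) \<Rightarrow> complex ^ 'n \<Rightarrow> complex ^ 'n \<Rightarrow> complex ^ 'n \<Rightarrow> complex" where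
  "d_one_form A z u v =
     (\<Sum>k\<in>UNIV. dir_deriv A z u $ k * v $ k - dir_deriv A z v $ k * u $ k)"

definition wedge_1_2 ::
    "('a \<Rightarrow> 'b \<Rightarrow> complex) \<Rightarrow> ('a \<Rightarrow> 'b \<Rightarrow> 'b \<Rightarrow> complex) \<Rightarrow> 'a \<Rightarrow> 'b \<Rightarrow> 'b \<Rightarrow> 'b \<Rightarrow> complex" where
  "wedge_1_2 \<alpha> \<beta> z u v w = \<alpha> z u * \<beta> z v w - \<alpha> z v * \<beta> z u w + \<alpha> z w * \<beta> z u v"

definition codim1_foliation :: "nat \<Rightarrow> (complex ^ 'n::finite \<Rightarrow> complex ^ 'n) \<Rightarrow> bool" where
  "codim1_foliation \<nu> A \<longleftrightarrow>
     (\<forall>k. hom_poly_fun (\<nu> + 1) (\<lambda>z. A z $ k)) \<and>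
     (\<forall>z u v w. wedge_1_2 (one_form A) (d_one_form A) z u v w = 0) \<and>
     (\<forall>z. (\<Sum>k\<in>UNIV. z $ k * A z $ k) = 0) \<and>
     codim {z. \<forall>k. A z $ k = 0} \<ge> 2"


section \<open>Holomorphic vector fields on projective space\<close>

text \<open>The affine chart \<open>z\<^sub>i \<noteq> 0\<close> of projective space is identified with the affine hyperplane
  \<open>x\<^sub>i = 1\<close>, by normalising homogeneous coordinates; its coordinates are the \<open>x\<^sub>j = z\<^sub>j / z\<^sub>i\<close> with
  \<open>j \<noteq> i\<close>, and its tangent space at each point is \<open>v\<^sub>i = 0\<close>. In this identification
  \<open>chart_change j\<close> is the transition map from any chart to the chart with index \<open>j\<close>.\<close>

definition chart :: "'n::finite \<Rightarrow> (complex ^ 'n) set" where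
  "chart i = {x. x $ i = 1}"

definition chart_change :: "'n::finite \<Rightarrow> complex ^ 'n \<Rightarrow> complex ^ 'n" where
  "chart_change j x = inverse (x $ j) *s x"

definition chart_holomorphic :: "'n::finite \<Rightarrow> (complex ^ 'n \<Rightarrow> complex ^ 'n) \<Rightarrow> bool" where
  "chart_holomorphic i F \<longleftrightarrow>
     (\<forall>x\<in>chart i. \<exists>D. Vector_Spaces.linear (*s) (*s) D \<and> (F has_derivative D) (at x within chart i))"

text \<open>A vector field is the family \<open>X i\<close> of its expressions in the charts, which have to agree via
  the differentials of the transition maps. The value outside the chart is normalised to \<open>0\<close>, so
  that equality of families is equality of vector fields.\<close>

type_synonym 'n vfield = "'n \<Rightarrow> complex ^ 'n \<Rightarrow> complex ^ 'n"

definition hol_vfields :: "'n::finite vfield set" where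
  "hol_vfields = {X.
     (\<forall>i. \<forall>x\<in>chart i. X i x $ i = 0) \<and>
     (\<forall>i. \<forall>x. x \<notin> chart i \<longrightarrow> X i x = 0) \<and>
     (\<forall>i. chart_holomorphic i (X i)) \<and>
     (\<forall>i j. \<forall>x\<in>chart i. x $ j \<noteq> 0 \<longrightarrow>
        X j (chart_change j x) = dir_deriv (chart_change j) x (X i x))}"

definition vf_scale :: "complex \<Rightarrow> 'n::finite vfield \<Rightarrow> 'n vfield" where
  "vf_scale c X = (\<lambda>i x. c *s X i x)"

global_interpretation vf: vector_space vf_scale
  by unfold_locales (auto simp: vf_scale_def fun_eq_iff vec_eq_iff algebra_simps)

definition lie_bracket :: "'n::finite vfield \<Rightarrow> 'n vfield \<Rightarrow> 'n vfield" where
  "lie_bracket X Y = (\<lambda>i x. if x \<in> chart i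
     then dir_deriv (Y i) x (X i x) - dir_deriv (X i) x (Y i x) else 0)"

definition lie_subalgebra :: "'n::finite vfield set \<Rightarrow> bool" where
  "lie_subalgebra L \<longleftrightarrow> L \<subseteq> hol_vfields \<and> vf.subspace L \<and> (\<forall>X\<in>L. \<forall>Y\<in>L. lie_bracket X Y \<in> L)"


section \<open>Foliations defined by Lie algebras\<close>

text \<open>The tangent space to the leaf through a nonsingular point, read in the chart \<open>i\<close>.\<close>

definition leaf_tangent ::
    "(complex ^ 'n::finite \<Rightarrow> complex ^ 'n) \<Rightarrow> 'n \<Rightarrow> complex ^ 'n \<Rightarrow> (complex ^ 'n) set" where
  "leaf_tangent A i x = {v. v $ i = 0 \<and> one_form A x v = 0}"

definition proper_projective_alg_set :: "(complex ^ 'n::finite) set \<Rightarrow> bool" where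
  "proper_projective_alg_set S \<longleftrightarrow>
     algebraic_set S \<and> S \<noteq> UNIV \<and> (\<forall>z\<in>S. \<forall>c. c \<noteq> 0 \<longrightarrow> c *s z \<in> S)"

text \<open>Generic means: off a proper algebraic subset of projective space, given by its cone \<open>S\<close>.\<close>

definition L_foliation :: "(complex ^ 'n::finite \<Rightarrow> complex ^ 'n) \<Rightarrow> bool" where
  "L_foliation A \<longleftrightarrow>
     (\<exists>L. lie_subalgebra L \<and>
        (\<exists>S. proper_projective_alg_set S \<and>
          (\<forall>i. \<forall>x\<in>chart i. x \<notin> S \<longrightarrow> A x \<noteq> 0 \<and> {X i x | X. X \<in> L} = leaf_tangent A i x)))"

text \<open>All holomorphic vector fields tangent to the foliation; this is the maximal Lie subalgebra
  that can occur in \<open>L_foliation\<close>. Tangency is a condition at nonsingular points only.\<close>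

definition tangent_algebra :: "(complex ^ 'n::finite \<Rightarrow> complex ^ 'n) \<Rightarrow> 'n vfield set" where
  "tangent_algebra A = {X \<in> hol_vfields.
     \<forall>i. \<forall>x\<in>chart i. A x \<noteq> 0 \<longrightarrow> X i x \<in> leaf_tangent A i x}"

end

theory Submission
  imports Defs "HOL-Complex_Analysis.Cauchy_Integral_Formula"
    "HOL-Computational_Algebra.Fundamental_Theorem_Algebra"
begin

text \<open>
  The proof compares two homogeneous \<open>1\<close>-forms on the space of homogeneous coordinates.  Every
  holomorphic vector field on projective space is induced by a linear vector field \<open>z \<mapsto> M z\<close>
  (\<open>vfield_linear\<close>).  Choose \<open>n - 1\<close> elements of the
  algebra that span the leaf tangent space at a generic point, with matrices \<open>M\<^sub>k\<close>.  The form
  \<open>\<eta>\<^sub>z(v) = det (z, M\<^sub>k z, v)\<close> (\<open>frame_form\<close>) has coefficients of degree \<open>n\<close>, is not zero, and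
  vanishes on the kernel of \<open>\<omega> = \<Sum> A\<^sub>k dz\<^sub>k\<close>.  So \<open>\<eta>\<close> is a multiple of \<open>\<omega>\<close> by a rational function,
  and since the zero set of \<open>\<omega>\<close> has codimension at least two, the multiplier is a polynomial, of
  degree \<open>n - (\<nu> + 1)\<close>.  Hence \<open>\<nu> \<le> n - 1\<close>.

  If \<open>\<nu> = n - 1\<close>, the multiplier is a nonzero constant.  For a field \<open>Y\<close> tangent to the foliation,
  with matrix \<open>N\<close>, replace one \<open>M\<^sub>k\<close> by \<open>N\<close>: the new form is again a constant multiple of \<open>\<omega>\<close>.  By
  Cramer's rule (\<open>frame_expansion\<close>), the coefficients of \<open>N z\<close> in terms of \<open>z\<close> and the \<open>M\<^sub>k z\<close> are
  quotients of such forms, so those at the \<open>M\<^sub>k z\<close> are constant, and \<open>Y\<close> is a linear combination of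
  the chosen fields.

  Two facts are needed on the way.  Linearity of vector fields follows from Liouville's theorem on the
  lines through the origin of a chart, because the transition functions force quadratic growth.
  Polynomiality of the multiplier (\<open>proportional_homogeneous\<close>) needs hypersurfaces to have
  Krull codimension at most one.  Unique factorization of multivariate polynomials is bypassed: a
  polynomial function is regarded as a polynomial in one distinguished coordinate over the ring of
  polynomial functions in the others, and divisibility is considered only up to factors from that
  ring, where pseudo-division plays the role of the Euclidean algorithm.  Either some combination of the
  \<open>A\<^sub>k\<close> is a nonzero element \<open>w\<close> of the coefficient ring, and then \<open>w \<eta>\<^sub>k\<close> is a multiple of \<open>A\<^sub>k\<close>
  and it suffices to compare degrees in the distinguished coordinate; or the \<open>A\<^sub>k\<close> have a common
  irreducible factor in this sense, whose zero set would be an irreducible subset of codimension at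
  most one in the zero set of \<open>\<omega>\<close>.
\<close>

section \<open>Polynomial functions\<close>

lemma poly_fun_zero [simp]: "poly_fun (\<lambda>z. 0)"
  unfolding poly_fun_def by (rule exI[of _ "{}"]) auto

lemma poly_fun_monomial: "poly_fun (\<lambda>z. c * monomial_fun a z)"
  unfolding poly_fun_def by (rule exI[of _ "{a}"], rule exI[of _ "\<lambda>_. c"]) auto

lemma poly_fun_add:
  assumes "poly_fun f" "poly_fun g"
  shows "poly_fun (\<lambda>z. f z + g z)"
proof -
  obtain S c where S: "finite S" "f = (\<lambda>z. \<Sum>a\<in>S. c a * monomial_fun a z)"
    using assms(1) unfolding poly_fun_def by blast
  obtain T d where T: "finite T" "g = (\<lambda>z. \<Sum>a\<in>T. d a * monomial_fun a z)"
    using assms(2) unfolding poly_fun_def by blast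
  let ?e = "\<lambda>a. (if a \<in> S then c a else 0) + (if a \<in> T then d a else 0)"
  have "f z + g z = (\<Sum>a\<in>S \<union> T. ?e a * monomial_fun a z)" for z
  proof -
    have 1: "f z = (\<Sum>a\<in>S \<union> T. (if a \<in> S then c a else 0) * monomial_fun a z)"
      unfolding S(2) by (rule sum.mono_neutral_cong_left) (use S(1) T(1) in auto)
    have 2: "g z = (\<Sum>a\<in>S \<union> T. (if a \<in> T then d a else 0) * monomial_fun a z)"
      unfolding T(2) by (rule sum.mono_neutral_cong_left) (use S(1) T(1) in auto)
    show ?thesis
      unfolding 1 2 by (simp add: sum.distrib distrib_right)
  qed
  then show ?thesis
    unfolding poly_fun_def
    by (intro exI[of _ "S \<union> T"] exI[of _ ?e] conjI ext) (use S(1) T(1) in simp)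
qed

lemma poly_fun_sum:
  assumes "\<And>i. i \<in> I \<Longrightarrow> poly_fun (f i)"
  shows "poly_fun (\<lambda>z. \<Sum>i\<in>I. f i z)"
  using assms
  by (induction I rule: infinite_finite_induct) (auto intro: poly_fun_add)

lemma monomial_fun_mult: "monomial_fun a z * monomial_fun b z = monomial_fun (\<lambda>k. a k + b k) z"
  by (simp add: monomial_fun_def power_add prod.distrib)

lemma poly_fun_mult:
  assumes "poly_fun f" "poly_fun g"
  shows "poly_fun (\<lambda>z. f z * g z)"
proof -
  obtain S c where S: "finite S" "f = (\<lambda>z. \<Sum>a\<in>S. c a * monomial_fun a z)"
    using assms(1) unfolding poly_fun_def by blast
  obtain T d where T: "finite T" "g = (\<lambda>z. \<Sum>a\<in>T. d a * monomial_fun a z)"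
    using assms(2) unfolding poly_fun_def by blast
  have "f z * g z = (\<Sum>a\<in>S. \<Sum>b\<in>T. (c a * d b) * monomial_fun (\<lambda>k. a k + b k) z)" for z
    unfolding S(2) T(2) sum_product monomial_fun_mult[symmetric] by (simp add: mult_ac)
  then show ?thesis
    by (simp add: poly_fun_sum poly_fun_monomial)
qed

lemma poly_fun_const [simp]: "poly_fun (\<lambda>z. c)"
  using poly_fun_monomial[of c "\<lambda>_. 0"] by (simp add: monomial_fun_def)

lemma poly_fun_coord [simp]: "poly_fun (\<lambda>z :: complex ^ 'n::finite. z $ k)"
proof -
  have "monomial_fun (\<lambda>j. if j = k then 1 else 0) z = z $ k"
    for z :: "complex ^ 'n"
    by (simp add: monomial_fun_def if_distrib prod.delta cong: if_cong)
  then show ?thesis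
    using poly_fun_monomial[of 1 "\<lambda>j. if j = k then 1 else 0"] by simp
qed

lemma poly_fun_prod:
  assumes "\<And>i. i \<in> I \<Longrightarrow> poly_fun (f i)"
  shows "poly_fun (\<lambda>z. \<Prod>i\<in>I. f i z)"
  using assms
  by (induction I rule: infinite_finite_induct) (auto intro: poly_fun_mult)

lemma poly_fun_power: "poly_fun f \<Longrightarrow> poly_fun (\<lambda>z. f z ^ m)"
  by (induction m) (auto intro: poly_fun_mult)

lemma poly_fun_minus: "poly_fun f \<Longrightarrow> poly_fun (\<lambda>z. - f z)"
  using poly_fun_mult[OF poly_fun_const[of "-1"]] by simp

lemma poly_fun_diff: "poly_fun f \<Longrightarrow> poly_fun g \<Longrightarrow> poly_fun (\<lambda>z. f z - g z)"
  using poly_fun_add[OF _ poly_fun_minus, of f g] by simp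

lemma poly_fun_matrix_vector: "poly_fun (\<lambda>z. (M *v z) $ k)"
  unfolding matrix_vector_mult_def by (auto intro!: poly_fun_sum poly_fun_mult)

lemma poly_fun_det:
  assumes "\<And>i j. poly_fun (\<lambda>z. B z $ i $ j)"
  shows "poly_fun (\<lambda>z. det (B z))"
  unfolding det_def by (intro poly_fun_sum poly_fun_mult poly_fun_prod poly_fun_const assms)

lemma poly_fun_compose:
  assumes f: "poly_fun f" and g: "\<And>k. poly_fun (\<lambda>z. g z $ k)"
  shows "poly_fun (\<lambda>z. f (g z))"
proof -
  obtain S c where S: "finite S" "f = (\<lambda>z. \<Sum>a\<in>S. c a * monomial_fun a z)"
    using f unfolding poly_fun_def by blast
  show ?thesis
    unfolding S(2) monomial_fun_def
    by (intro poly_fun_sum poly_fun_mult poly_fun_prod poly_fun_const poly_fun_power g)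
qed

lemma poly_fun_continuous:
  assumes "poly_fun f"
  shows "continuous_on UNIV f"
proof -
  obtain S c where S: "f = (\<lambda>z. \<Sum>a\<in>S. c a * monomial_fun a z)"
    using assms unfolding poly_fun_def by blast
  show ?thesis
    unfolding S monomial_fun_def by (intro continuous_intros)
qed

lemma poly_fun_on_line:
  assumes "poly_fun f"
  obtains p where "\<And>t. f (a + t *s v) = poly p t"
proof -
  obtain S c where S: "f = (\<lambda>z. \<Sum>a\<in>S. c a * monomial_fun a z)"
    using assms unfolding poly_fun_def by blast
  let ?p = "\<Sum>b\<in>S. smult (c b) (\<Prod>k\<in>UNIV. [:a $ k, v $ k:] ^ b k)"
  have "f (a + t *s v) = poly ?p t" for t
    unfolding S monomial_fun_def
    by (simp add: poly_sum poly_prod poly_power vector_scalar_mult_def)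
  then show thesis
    by (rule that)
qed

text \<open>Two polynomial functions that do not vanish at \<open>a\<close> and \<open>b\<close> respectively restrict to nonzero
  polynomials on the line through \<open>a\<close> and \<open>b\<close>, whose product is nonzero.\<close>

lemma poly_fun_integral_domain:
  assumes "poly_fun f" "poly_fun g" and a: "f a \<noteq> 0" and b: "g b \<noteq> 0"
  obtains z where "f z \<noteq> 0" "g z \<noteq> 0"
proof -
  obtain p where p: "\<And>t. f (a + t *s (b - a)) = poly p t"
    using poly_fun_on_line[OF assms(1)] by blast
  obtain q where q: "\<And>t. g (a + t *s (b - a)) = poly q t"
    using poly_fun_on_line[OF assms(2)] by blast
  have "poly p 0 \<noteq> 0" "poly q 1 \<noteq> 0"
    using a b p[of 0] q[of 1] by auto
  then have "p * q \<noteq> 0"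
    by auto
  then obtain t where "poly (p * q) t \<noteq> 0"
    using poly_all_0_iff_0 by blast
  then show thesis
    using that[of "a + t *s (b - a)"] p q by auto
qed

lemma poly_fun_vanishing_extends:
  assumes "poly_fun g" "poly_fun s" "s a \<noteq> 0" and "\<And>z. s z \<noteq> 0 \<Longrightarrow> g z = 0"
  shows "g z = 0"
  using poly_fun_integral_domain[OF assms(1,2) _ assms(3), of z] assms(4) by blast

lemma poly_fun_vanishing_extends2:
  assumes "poly_fun g" "poly_fun s" "s a \<noteq> 0" "poly_fun s'" "s' a' \<noteq> 0"
    and "\<And>z. s z \<noteq> 0 \<Longrightarrow> s' z \<noteq> 0 \<Longrightarrow> g z = 0"
  shows "g z = 0"
proof -
  obtain b where "s b \<noteq> 0" "s' b \<noteq> 0"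
    using poly_fun_integral_domain[OF assms(2,4,3,5)] by blast
  then show ?thesis
    using poly_fun_vanishing_extends[OF assms(1) poly_fun_mult[OF assms(2,4)], of b z] assms(6)
    by auto
qed

lemma hom_poly_fun_imp_poly_fun: "hom_poly_fun d f \<Longrightarrow> poly_fun f"
  unfolding hom_poly_fun_def poly_fun_def by blast

lemma hom_poly_fun_scale:
  assumes "hom_poly_fun d f"
  shows "f (t *s z) = t ^ d * f z"
proof -
  obtain S c where S: "\<And>a. a \<in> S \<Longrightarrow> (\<Sum>k\<in>UNIV. a k) = d"
    "f = (\<lambda>z. \<Sum>a\<in>S. c a * monomial_fun a z)"
    using assms unfolding hom_poly_fun_def by blast
  have "monomial_fun a (t *s z) = t ^ d * monomial_fun a z" if "a \<in> S" for a
    using S(1)[OF that]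
    by (simp add: monomial_fun_def power_mult_distrib prod.distrib flip: power_sum)
  then show ?thesis
    unfolding S(2) sum_distrib_left by (intro sum.cong) (auto simp: mult_ac)
qed

text \<open>The restriction of a homogeneous function of degree \<open>d\<close> to the line \<open>y + t e\<close> is
  \<open>t\<^sup>d f (y / t + e)\<close>, so its growth as \<open>t \<rightarrow> \<infinity>\<close> is read off at \<open>e\<close>.\<close>

lemma homogeneous_on_line:
  fixes f :: "complex ^ 'n \<Rightarrow> complex"
  assumes f: "poly_fun f" and hom: "\<And>t z. f (t *s z) = t ^ d * f z"
    and q: "\<And>t. f (y + t *s e) = poly q t"
  shows "degree q \<le> d" "coeff q d = f e"
proof -
  have "((\<lambda>t. f (inverse t *s y + e)) \<longlongrightarrow> f (0 *s y + e)) at_infinity"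
  proof (rule continuous_on_tendsto_compose[OF poly_fun_continuous[OF f]])
    show "((\<lambda>t. inverse t *s y + e) \<longlongrightarrow> 0 *s y + e) at_infinity"
      by (intro vec_tendstoI)
        (simp only: vector_add_component vector_smult_component,
          intro tendsto_add tendsto_mult tendsto_const tendsto_inverse_0)
  qed auto
  moreover have "\<forall>\<^sub>F t in at_infinity. f (inverse t *s y + e) = poly q t / t ^ d"
    using eventually_not_equal_at_infinity[of 0]
  proof eventually_elim
    case (elim t)
    have "y + t *s e = t *s (inverse t *s y + e)"
      using elim by (simp add: vec_eq_iff algebra_simps)
    then show ?case
      using elim q[of t] hom[of t "inverse t *s y + e"] by simp
  qed
  ultimately have lim: "((\<lambda>t. poly q t / t ^ d) \<longlongrightarrow> f e) at_infinity"
    by (simp add: tendsto_cong)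
  have lim0: "((\<lambda>t::complex. inverse (t ^ m)) \<longlongrightarrow> 0) at_infinity" if "m > 0" for m
    by (rule filterlim_compose[OF tendsto_inverse_0 filterlim_power_at_infinity])
      (use that filterlim_ident in auto)
  show le: "degree q \<le> d"
  proof (rule ccontr)
    assume neg: "\<not> degree q \<le> d"
    have "((\<lambda>t. poly q t / t ^ d * inverse (t ^ (degree q - d))) \<longlongrightarrow> f e * 0) at_infinity"
      by (intro tendsto_mult lim lim0) (use neg in auto)
    moreover have "\<forall>\<^sub>F t in at_infinity. poly q t / t ^ d * inverse (t ^ (degree q - d)) =
        poly q t / t ^ degree q"
      using eventually_not_equal_at_infinity[of 0]
    proof eventually_elim
      case (elim t)
      have "t ^ degree q = t ^ d * t ^ (degree q - d)"
        using neg by (simp flip: power_add)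
      then show ?case
        by (simp add: divide_inverse mult.assoc)
    qed
    ultimately have "((\<lambda>t. poly q t / t ^ degree q) \<longlongrightarrow> 0) at_infinity"
      by (simp add: tendsto_cong)
    then have "lead_coeff q = 0"
      using tendsto_unique[OF _ poly_divide_tendsto_aux] trivial_limit_at_infinity by blast
    with neg show False
      by auto
  qed
  show "coeff q d = f e"
  proof (cases "degree q = d")
    case True
    then show ?thesis
      using tendsto_unique[OF _ poly_divide_tendsto_aux[of q]] lim trivial_limit_at_infinity
      by blast
  next
    case False
    have "((\<lambda>t. poly q t / t ^ degree q * inverse (t ^ (d - degree q))) \<longlongrightarrow> lead_coeff q * 0) at_infinity"
      by (intro tendsto_mult lim0 poly_divide_tendsto_aux) (use False le in auto)
    moreover have "\<forall>\<^sub>F t in at_infinity. poly q t / t ^ degree q * inverse (t ^ (d - degree q)) =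
        poly q t / t ^ d"
      using eventually_not_equal_at_infinity[of 0]
    proof eventually_elim
      case (elim t)
      have "t ^ d = t ^ degree q * t ^ (d - degree q)"
        using le by (simp flip: power_add)
      then show ?case
        by (simp add: divide_inverse mult.assoc)
    qed
    ultimately have "((\<lambda>t. poly q t / t ^ d) \<longlongrightarrow> 0) at_infinity"
      by (simp add: tendsto_cong)
    then have "f e = 0"
      using tendsto_unique[OF _ lim] trivial_limit_at_infinity by blast
    then show ?thesis
      using False le by (simp add: coeff_eq_0)
  qed
qed

section \<open>Divisibility over the field of fractions of the coefficients\<close>

text \<open>Divisibility and irreducibility in \<open>K[x]\<close>, where \<open>K\<close> is the field of fractions of the
  coefficient domain, expressed with cleared denominators.\<close>

definition fdvd :: "'a::idom poly \<Rightarrow> 'a poly \<Rightarrow> bool" where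
  "fdvd D f \<longleftrightarrow> (\<exists>c. c \<noteq> 0 \<and> D dvd smult c f)"

definition firreducible :: "'a::idom poly \<Rightarrow> bool" where
  "firreducible D \<longleftrightarrow> degree D > 0 \<and> (\<forall>E. fdvd E D \<and> degree E > 0 \<longrightarrow> degree E = degree D)"

lemma fdvd_trans: "fdvd D E \<Longrightarrow> fdvd E f \<Longrightarrow> fdvd D f"
proof -
  assume "fdvd D E" "fdvd E f"
  then obtain b c s t where "b \<noteq> 0" "c \<noteq> 0" "smult b E = D * s" "smult c f = E * t"
    unfolding fdvd_def dvd_def by blast
  then have "smult (b * c) f = D * (s * t)" "b * c \<noteq> 0"
    by (simp_all flip: smult_smult) (metis mult_smult_left mult.assoc)
  then show ?thesis
    unfolding fdvd_def dvd_def by blast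
qed

lemma fdvd_degree_le:
  assumes "fdvd D f" "f \<noteq> 0"
  shows "degree D \<le> degree f"
proof -
  obtain c s where "c \<noteq> 0" "smult c f = D * s"
    using assms(1) unfolding fdvd_def dvd_def by blast
  then show ?thesis
    using assms(2) degree_mult_eq[of D s] by (metis degree_smult_eq le_add1 mult_eq_0_iff smult_eq_0_iff)
qed

lemma pseudo_division:
  fixes D f :: "'a::idom poly"
  assumes "D \<noteq> 0"
  obtains k q r where "smult (lead_coeff D ^ k) f = D * q + r" "r = 0 \<or> degree r < degree D"
  using pseudo_divmod[OF assms, of f] by (metis surj_pair)

text \<open>The denominator in \<open>fdvd D f\<close> depends on \<open>f\<close>.  A denominator of this form is nonzero wherever the
  leading coefficient of \<open>D\<close> is, so that one point serves for all \<open>f\<close> at once.\<close>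

lemma fdvd_lead_coeff_power:
  fixes D f :: "'a::idom poly"
  assumes "fdvd D f" "D \<noteq> 0"
  obtains k where "D dvd smult (lead_coeff D ^ k) f"
proof -
  obtain k q r where kqr: "smult (lead_coeff D ^ k) f = D * q + r" "r = 0 \<or> degree r < degree D"
    using pseudo_division[OF assms(2)] by metis
  obtain c where c: "c \<noteq> 0" "D dvd smult c f"
    using assms(1) unfolding fdvd_def by blast
  have "smult c (smult (lead_coeff D ^ k) f) = smult (lead_coeff D ^ k) (smult c f)"
    by (simp add: mult.commute)
  then have "smult c (D * q + r) = smult (lead_coeff D ^ k) (smult c f)"
    by (simp only: kqr(1))
  then have "D * smult c q + smult c r = smult (lead_coeff D ^ k) (smult c f)"
    by (simp add: smult_add_right)
  moreover have "D dvd smult (lead_coeff D ^ k) (smult c f)"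
    by (rule dvd_smult[OF c(2)])
  ultimately have "D dvd smult c r"
    by (metis dvd_add_right_iff dvd_triv_left)
  then have "fdvd D r"
    using c(1) unfolding fdvd_def by blast
  then have "r = 0"
    using fdvd_degree_le kqr(2) by fastforce
  then show thesis
    using kqr(1) that by (metis add.right_neutral dvd_triv_left)
qed

text \<open>Over \<open>K\<close> the ideal is principal: an element of least degree divides all others, since the
  remainder of a pseudo-division stays in the ideal.\<close>

lemma ideal_fraction_generator:
  fixes I :: "'a::idom poly set"
  assumes add: "\<And>f g. f \<in> I \<Longrightarrow> g \<in> I \<Longrightarrow> f + g \<in> I"
    and mult: "\<And>u f. f \<in> I \<Longrightarrow> u * f \<in> I"
    and nz: "f0 \<in> I" "f0 \<noteq> 0"
  obtains G where "G \<in> I" "G \<noteq> 0" "\<And>f. f \<in> I \<Longrightarrow> fdvd G f"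
proof -
  obtain G where G: "G \<in> I" "G \<noteq> 0" and min: "\<And>f. f \<in> I \<Longrightarrow> f \<noteq> 0 \<Longrightarrow> degree G \<le> degree f"
    using ex_has_least_nat[of "\<lambda>f. f \<in> I \<and> f \<noteq> 0" f0 degree] nz by blast
  have "fdvd G f" if "f \<in> I" for f
  proof -
    obtain k q r where kqr: "smult (lead_coeff G ^ k) f = G * q + r" "r = 0 \<or> degree r < degree G"
      using pseudo_division[OF G(2)] by metis
    have "[:lead_coeff G ^ k:] * f + (- q) * G = r"
      using kqr(1) by (simp add: algebra_simps)
    then have "r \<in> I"
      using add[OF mult[OF that] mult[OF G(1)]] by metis
    then have "r = 0"
      using min kqr(2) by fastforce
    moreover have "lead_coeff G ^ k \<noteq> 0"
      using G(2) by simp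
    ultimately show ?thesis
      using kqr(1) unfolding fdvd_def by (metis add.right_neutral dvd_triv_left)
  qed
  then show thesis
    using that G by blast
qed

lemma firreducible_factor_exists:
  fixes G :: "'a::idom poly"
  assumes "degree G > 0"
  obtains D where "firreducible D" "fdvd D G"
proof -
  have "fdvd G G"
    unfolding fdvd_def by (rule exI[of _ 1]) simp
  then obtain D where D: "degree D > 0" "fdvd D G"
    and min: "\<And>E. degree E > 0 \<Longrightarrow> fdvd E G \<Longrightarrow> degree D \<le> degree E"
    using ex_has_least_nat[of "\<lambda>D. degree D > 0 \<and> fdvd D G" G degree] assms by blast
  have "degree E = degree D" if "fdvd E D" "degree E > 0" for E
  proof (rule antisym)
    show "degree E \<le> degree D"
      by (rule fdvd_degree_le[OF that(1)]) (use D(1) in auto)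
    show "degree D \<le> degree E"
      by (rule min[OF that(2) fdvd_trans[OF that(1) D(2)]])
  qed
  then show thesis
    using that D unfolding firreducible_def by blast
qed

text \<open>The ideal generated by \<open>D\<close> and \<open>f\<close> is principal over \<open>K\<close>; a generator of positive degree would
  divide \<open>D\<close>, hence have the degree of \<open>D\<close>, and so be \<open>D\<close> up to coefficients.\<close>

lemma firreducible_bezout:
  fixes D f :: "'a::idom poly"
  assumes D: "firreducible D" and f: "\<not> fdvd D f"
  obtains u v w where "w \<noteq> 0" "u * D + v * f = [:w:]"
proof -
  define I where "I = {u * D + v * f | u v. True}"
  have D0: "degree D > 0" "D \<noteq> 0"
    using D unfolding firreducible_def by auto
  have "1 * D + 0 * f \<in> I" "0 * D + 1 * f \<in> I"
    unfolding I_def by blast+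
  then have DI: "D \<in> I" and fI: "f \<in> I"
    by simp_all
  have add: "g + h \<in> I" if "g \<in> I" "h \<in> I" for g h
  proof -
    obtain u v u' v' where "g = u * D + v * f" "h = u' * D + v' * f"
      using \<open>g \<in> I\<close> \<open>h \<in> I\<close> unfolding I_def by blast
    then have "g + h = (u + u') * D + (v + v') * f"
      by (simp add: algebra_simps)
    then show ?thesis
      unfolding I_def by blast
  qed
  have mult: "s * g \<in> I" if "g \<in> I" for s g
  proof -
    obtain u v where "g = u * D + v * f"
      using \<open>g \<in> I\<close> unfolding I_def by blast
    then have "s * g = (s * u) * D + (s * v) * f"
      by (simp add: algebra_simps)
    then show ?thesis
      unfolding I_def by blast
  qed
  obtain G where G: "G \<in> I" "G \<noteq> 0" and div: "\<And>g. g \<in> I \<Longrightarrow> fdvd G g"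
    using ideal_fraction_generator[OF add mult DI D0(2)] by metis
  have "degree G = 0"
  proof (rule ccontr)
    assume "degree G \<noteq> 0"
    then have deg: "degree G = degree D"
      using D div[OF DI] unfolding firreducible_def by blast
    obtain c q where c: "c \<noteq> 0" "smult c D = G * q"
      using div[OF DI] unfolding fdvd_def dvd_def by blast
    obtain c' q' where c': "c' \<noteq> 0" "smult c' f = G * q'"
      using div[OF fI] unfolding fdvd_def dvd_def by blast
    have "q \<noteq> 0"
      using c D0(2) by auto
    then have "degree (G * q) = degree G + degree q"
      using G(2) by (simp add: degree_mult_eq)
    then have "degree q = 0"
      using c deg by (metis add_cancel_right_right degree_smult_eq)
    then obtain q0 where q0: "q = [:q0:]" "q0 \<noteq> 0"
      using \<open>q \<noteq> 0\<close> degree_eq_zeroE by (metis pCons_0_0)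
    have "smult (q0 * c') f = D * smult c q'"
      using c(2) c'(2) q0(1)
      by (metis (no_types, lifting) mult.commute mult_pCons_left mult_smult_left mult_smult_right
          add.right_neutral mult_zero_left pCons_0_0 smult_smult)
    then have "fdvd D f"
      using q0(2) c'(1) unfolding fdvd_def by (metis dvd_triv_left mult_eq_0_iff)
    with f show False ..
  qed
  then obtain w where w: "G = [:w:]"
    using degree_eq_zeroE by blast
  then have "w \<noteq> 0"
    using G(2) by auto
  moreover obtain u v where "G = u * D + v * f"
    using G(1) unfolding I_def by blast
  ultimately show thesis
    using that w by metis
qed

lemma firreducible_prime:
  fixes D f g :: "'a::idom poly"
  assumes D: "firreducible D" and fg: "fdvd D (f * g)"
  shows "fdvd D f \<or> fdvd D g"
proof (rule disjCI)
  assume "\<not> fdvd D g"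
  then obtain u v w where w: "w \<noteq> 0" "u * D + v * g = [:w:]"
    using firreducible_bezout[OF D] by metis
  obtain c where c: "c \<noteq> 0" "D dvd smult c (f * g)"
    using fg unfolding fdvd_def by blast
  have "smult (c * w) f = smult c (f * [:w:])"
    by (simp add: mult.commute)
  also have "\<dots> = smult c (f * (u * D + v * g))"
    by (simp only: w(2))
  also have "\<dots> = smult c (f * u) * D + v * smult c (f * g)"
    by (simp add: algebra_simps smult_add_right)
  finally have "D dvd smult (c * w) f"
    using c(2) by (metis dvd_add dvd_mult dvd_triv_right)
  then show "fdvd D f"
    using c(1) w(1) unfolding fdvd_def by (metis mult_eq_0_iff)
qed

text \<open>The prime ideal \<open>{f. fdvd D f}\<close> has height one.  Take an element \<open>E\<close> of least degree in a
  nonzero prime ideal \<open>Q\<close> below it.  Up to a factor from the coefficients, \<open>E\<close> is a multiple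
  \<open>D q\<close>; minimality excludes \<open>q \<in> Q\<close>, so \<open>D \<in> Q\<close>.\<close>

lemma firreducible_height_one:
  fixes Q :: "'a::idom poly set"
  assumes D: "firreducible D"
    and mult: "\<And>u f. f \<in> Q \<Longrightarrow> u * f \<in> Q"
    and prime: "\<And>f g. f * g \<in> Q \<Longrightarrow> f \<in> Q \<or> g \<in> Q"
    and sub: "\<And>f. f \<in> Q \<Longrightarrow> fdvd D f"
    and nz: "f0 \<in> Q" "f0 \<noteq> 0"
    and f: "fdvd D f"
  shows "f \<in> Q"
proof -
  have D0: "degree D > 0" "D \<noteq> 0"
    using D unfolding firreducible_def by auto
  obtain E where E: "E \<in> Q" "E \<noteq> 0" and min: "\<And>g. g \<in> Q \<Longrightarrow> g \<noteq> 0 \<Longrightarrow> degree E \<le> degree g"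
    using ex_has_least_nat[of "\<lambda>g. g \<in> Q \<and> g \<noteq> 0" f0 degree] nz by blast
  obtain c q where c: "c \<noteq> 0" "smult c E = D * q"
    using sub[OF E(1)] unfolding fdvd_def dvd_def by blast
  have "q \<noteq> 0"
    using c E(2) by auto
  then have "degree E = degree D + degree q"
    using c D0(2) by (metis degree_mult_eq degree_smult_eq)
  then have "q \<notin> Q"
    using min[of q] \<open>q \<noteq> 0\<close> D0(1) by auto
  moreover have "D * q \<in> Q"
    using mult[OF E(1), of "[:c:]"] c(2) by simp
  ultimately have "D \<in> Q"
    using prime by blast
  obtain b s where b: "b \<noteq> 0" "smult b f = D * s"
    using f unfolding fdvd_def dvd_def by blast
  have "[:b:] * f = s * D"
    using b(2) by (simp add: mult.commute)
  then have "[:b:] * f \<in> Q"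
    using mult[OF \<open>D \<in> Q\<close>, of s] by simp
  moreover have "[:b:] \<notin> Q"
    using sub[of "[:b:]"] fdvd_degree_le[of D "[:b:]"] b(1) D0(1) by fastforce
  ultimately show ?thesis
    using prime by blast
qed

section \<open>Polynomial functions as polynomials in one distinguished coordinate\<close>

text \<open>The coefficient ring below is a type, so the coordinate has to be fixed once and for all; the
  freedom of choosing a direction is recovered by the vector \<open>e\<close> in \<open>as_fun\<close>.\<close>

definition base_coord :: "'n::finite" where
  "base_coord = undefined"

text \<open>The coefficient ring: polynomial functions of the remaining coordinates, kept as functions on
  the whole space that are constant along the distinguished axis.\<close>

typedef 'n base = "{r :: complex ^ 'n::finite \<Rightarrow> complex.
    poly_fun r \<and> (\<forall>z t. r (z + t *s axis base_coord 1) = r z)}"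
  morphisms bval Abs_base
  by (rule exI[of _ "\<lambda>_. 0"]) simp

setup_lifting type_definition_base

instantiation base :: (finite) idom
begin

lift_definition zero_base :: "'a base" is "\<lambda>_. 0" by simp
lift_definition one_base :: "'a base" is "\<lambda>_. 1" by simp
lift_definition plus_base :: "'a base \<Rightarrow> 'a base \<Rightarrow> 'a base" is "\<lambda>r s z. r z + s z"
  by (simp add: poly_fun_add)
lift_definition minus_base :: "'a base \<Rightarrow> 'a base \<Rightarrow> 'a base" is "\<lambda>r s z. r z - s z"
  by (simp add: poly_fun_diff)
lift_definition uminus_base :: "'a base \<Rightarrow> 'a base" is "\<lambda>r z. - r z"
  by (simp add: poly_fun_minus)
lift_definition times_base :: "'a base \<Rightarrow> 'a base \<Rightarrow> 'a base" is "\<lambda>r s z. r z * s z"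
  by (simp add: poly_fun_mult)

instance
proof
  fix a b c :: "'a base"
  show "a * b * c = a * (b * c)" by transfer (simp add: mult.assoc)
  show "a * b = b * a" by transfer (simp add: mult.commute)
  show "1 * a = a" by transfer simp
  show "a + b + c = a + (b + c)" by transfer (simp add: add.assoc)
  show "a + b = b + a" by transfer (simp add: add.commute)
  show "0 + a = a" by transfer simp
  show "- a + a = 0" by transfer simp
  show "a - b = a + - b" by transfer simp
  show "(a + b) * c = a * c + b * c" by transfer (simp add: distrib_right)
  show "a * (b + c) = a * b + a * c" by transfer (simp add: distrib_left)
  show "0 * a = 0" "a * 0 = 0" by (transfer, simp)+
  show "(0 :: 'a base) \<noteq> 1" by transfer (simp add: fun_eq_iff)
  show "a * b \<noteq> 0" if "a \<noteq> 0" "b \<noteq> 0"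
    using that
  proof transfer
    fix a b :: "complex ^ 'a \<Rightarrow> complex"
    assume "poly_fun a \<and> (\<forall>z t. a (z + t *s axis base_coord 1) = a z)"
      "poly_fun b \<and> (\<forall>z t. b (z + t *s axis base_coord 1) = b z)" "a \<noteq> (\<lambda>_. 0)" "b \<noteq> (\<lambda>_. 0)"
    then show "(\<lambda>z. a z * b z) \<noteq> (\<lambda>_. 0)"
      using poly_fun_integral_domain[of a b] by (metis mult_eq_0_iff)
  qed
qed

end

lemma bval_0 [simp]: "bval 0 y = 0" by transfer simp
lemma bval_1 [simp]: "bval 1 y = 1" by transfer simp
lemma bval_add [simp]: "bval (r + s) y = bval r y + bval s y" by transfer simp
lemma bval_mult [simp]: "bval (r * s) y = bval r y * bval s y" by transfer simp
lemma bval_power [simp]: "bval (r ^ k) y = bval r y ^ k" by (induction k) auto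
lemma bval_sum: "bval (\<Sum>i\<in>I. r i) y = (\<Sum>i\<in>I. bval (r i) y)"
  by (induction I rule: infinite_finite_induct) auto
lemma poly_fun_bval: "poly_fun (bval r)" by transfer simp
lemma bval_shift: "bval r (z + t *s axis base_coord 1) = bval r z" by transfer simp
lemma bval_nonzero: "r \<noteq> 0 \<Longrightarrow> \<exists>y. bval r y \<noteq> 0" by transfer auto
lemma bval_eqI: "(\<And>y. bval r y = bval s y) \<Longrightarrow> r = s" by transfer auto

definition specialize :: "'n::finite base poly \<Rightarrow> complex ^ 'n \<Rightarrow> complex poly" where
  "specialize p y = map_poly (\<lambda>r. bval r y) p"

lemma coeff_specialize [simp]: "coeff (specialize p y) k = bval (coeff p k) y"
  by (simp add: specialize_def coeff_map_poly)

lemma specialize_add: "specialize (p + q) y = specialize p y + specialize q y"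
  by (simp add: poly_eq_iff)

lemma specialize_mult: "specialize (p * q) y = specialize p y * specialize q y"
  by (simp add: poly_eq_iff coeff_mult bval_sum)

lemma specialize_smult: "specialize (smult c p) y = smult (bval c y) (specialize p y)"
  by (simp add: poly_eq_iff)

lemma specialize_const: "specialize [:w:] y = [:bval w y:]"
  by (simp add: poly_eq_iff coeff_pCons split: nat.split)

text \<open>The polynomial function belonging to \<open>p\<close> in the linear coordinates in which \<open>e\<close> is the
  direction of the distinguished axis: every point is \<open>y + t e\<close> with \<open>y\<close> in the hyperplane
  where the distinguished coordinate vanishes.\<close>

definition as_fun :: "complex ^ 'n::finite \<Rightarrow> 'n base poly \<Rightarrow> complex ^ 'n \<Rightarrow> complex" where
  "as_fun e p z = poly (specialize p (z - z $ base_coord *s e)) (z $ base_coord)"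

lemma as_fun_add: "as_fun e (p + q) z = as_fun e p z + as_fun e q z"
  and as_fun_mult: "as_fun e (p * q) z = as_fun e p z * as_fun e q z"
  by (simp_all add: as_fun_def specialize_add specialize_mult)

lemma as_fun_const: "as_fun e [:w:] z = bval w (z - z $ base_coord *s e)"
  by (simp add: as_fun_def specialize_const)

lemma poly_fun_as_fun: "poly_fun (as_fun e p)"
proof -
  have proj: "poly_fun (\<lambda>z. bval r (z - z $ base_coord *s e))" for r
    by (rule poly_fun_compose[OF poly_fun_bval])
      (simp add: poly_fun_diff poly_fun_mult)
  have "as_fun e p z = (\<Sum>k\<le>degree p. bval (coeff p k) (z - z $ base_coord *s e) * z $ base_coord ^ k)" for z
  proof -
    have "degree (specialize p (z - z $ base_coord *s e)) \<le> degree p"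
      by (rule degree_le) (simp add: coeff_eq_0)
    then show ?thesis
      unfolding as_fun_def poly_altdef
      by (subst sum.mono_neutral_left[of "{..degree p}"]) (auto intro!: le_degree)
  qed
  then have "as_fun e p = (\<lambda>z. \<Sum>k\<le>degree p. bval (coeff p k) (z - z $ base_coord *s e) * z $ base_coord ^ k)"
    by blast
  then show ?thesis
    by (simp only:) (intro poly_fun_sum poly_fun_mult poly_fun_power poly_fun_coord proj)
qed

text \<open>The point \<open>y'\<close> is the projection of \<open>y\<close> to the hyperplane where the distinguished coordinate
  vanishes; elements of the coefficient ring do not distinguish the two.\<close>

lemma as_fun_on_line:
  fixes e y :: "complex ^ 'n::finite"
  assumes "e $ base_coord = 1"
  obtains y' where "\<And>p t. as_fun e p (y' + t *s e) = poly (specialize p y) t"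
proof -
  let ?y = "y + (- (y $ base_coord)) *s axis base_coord 1"
  have "specialize p ?y = specialize p y" for p
    by (simp only: poly_eq_iff coeff_specialize bval_shift) simp
  then have "as_fun e p (?y + t *s e) = poly (specialize p y) t" for p t
    using assms by (simp add: as_fun_def)
  then show thesis
    by (rule that)
qed

lemma as_fun_inj:
  fixes e :: "complex ^ 'n::finite"
  assumes e: "e $ base_coord = 1" and eq: "\<And>z. as_fun e p z = as_fun e q z"
  shows "p = q"
proof (rule poly_eqI)
  fix k
  show "coeff p k = coeff q k"
  proof (rule bval_eqI)
    fix y
    obtain y' where y': "\<And>p t. as_fun e p (y' + t *s e) = poly (specialize p y) t"
      using as_fun_on_line[OF e] by blast
    have "poly (specialize p y) t = poly (specialize q y) t" for t
      using eq y' by metis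
    then have "specialize p y = specialize q y"
      using poly_eq_poly_eq_iff by blast
    then show "bval (coeff p k) y = bval (coeff q k) y"
      by (metis coeff_specialize)
  qed
qed

lemma as_fun_surj:
  fixes e :: "complex ^ 'n::finite"
  assumes e: "e $ base_coord = 1" and f: "poly_fun f"
  obtains p where "as_fun e p = f"
proof -
  have const: "\<exists>p. as_fun e p = (\<lambda>z. c)" for c
  proof -
    have "bval (Abs_base (\<lambda>_. c)) y = c" for y :: "complex ^ 'n"
      by (subst Abs_base_inverse) auto
    then show ?thesis
      by (intro exI[of _ "[:Abs_base (\<lambda>_. c):]"]) (simp add: as_fun_const fun_eq_iff)
  qed
  have mult: "\<exists>p. as_fun e p = (\<lambda>z. f z * g z)"
    if "\<exists>p. as_fun e p = f" "\<exists>p. as_fun e p = g" for f g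
    using that as_fun_mult by (metis ext)
  have add: "\<exists>p. as_fun e p = (\<lambda>z. f z + g z)"
    if "\<exists>p. as_fun e p = f" "\<exists>p. as_fun e p = g" for f g
    using that as_fun_add by (metis ext)
  have t: "as_fun e [:0, 1:] = (\<lambda>z. z $ base_coord)"
  proof
    fix z
    have "specialize [:0, 1:] y = [:0, 1:]" for y :: "complex ^ 'n"
      by (simp add: poly_eq_iff coeff_pCons split: nat.split)
    then show "as_fun e [:0, 1:] z = z $ base_coord"
      by (simp add: as_fun_def)
  qed
  have coord: "\<exists>p. as_fun e p = (\<lambda>z. z $ k)" for k
  proof (cases "k = base_coord")
    case True
    then show ?thesis
      using t by blast
  next
    case False
    have b: "bval (Abs_base (\<lambda>z. z $ k)) y = y $ k" for y
      by (subst Abs_base_inverse) (use False in \<open>auto simp: axis_def\<close>)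
    obtain p where p: "as_fun e p = (\<lambda>z. e $ k)"
      using const by blast
    have "as_fun e ([:Abs_base (\<lambda>z. z $ k):] + p * [:0, 1:]) z = z $ k" for z
      by (simp only: as_fun_add as_fun_mult as_fun_const b p t) (simp add: mult.commute)
    then show ?thesis
      by blast
  qed
  have power: "\<exists>p. as_fun e p = (\<lambda>z. f z ^ m)" if "\<exists>p. as_fun e p = f" for f m
    by (induction m) (use const[of 1] mult[OF that] in auto)
  have prod: "\<exists>p. as_fun e p = (\<lambda>z. \<Prod>i\<in>I. f i z)" if "\<And>i. \<exists>p. as_fun e p = f i"
    for f and I :: "'n set"
    by (induction I rule: infinite_finite_induct) (use const[of 1] mult[OF that] in auto)
  have sum: "\<exists>p. as_fun e p = (\<lambda>z. \<Sum>i\<in>I. f i z)" if "\<And>i. \<exists>p. as_fun e p = f i"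
    for f and I :: "('n \<Rightarrow> nat) set"
    by (induction I rule: infinite_finite_induct) (use const[of 0] add[OF that] in auto)
  obtain S c where S: "f = (\<lambda>z. \<Sum>a\<in>S. c a * monomial_fun a z)"
    using f unfolding poly_fun_def by blast
  have "\<exists>p. as_fun e p = f"
    unfolding S monomial_fun_def by (intro sum mult const prod power coord)
  then show thesis
    using that by blast
qed

section \<open>Hypersurfaces have codimension at most one\<close>

text \<open>The Zariski closure of the part of the hypersurface \<open>D = 0\<close> that dominates the hyperplane of the
  other coordinates; components on which only coefficients vanish are removed.\<close>

definition generic_zeros :: "complex ^ 'n::finite \<Rightarrow> 'n base poly \<Rightarrow> (complex ^ 'n) set" where
  "generic_zeros e D = {z. \<forall>p. fdvd D p \<longrightarrow> as_fun e p z = 0}"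

text \<open>By the Bezout relation \<open>u D + v f = w\<close>, it suffices to find a zero of \<open>D\<close> on a line where the
  coefficient \<open>w\<close> does not vanish.  Choosing the line so that the leading coefficient of \<open>D\<close> does not
  vanish either makes \<open>D\<close> nonconstant there, and makes its root a common zero of all \<open>p\<close>
  with \<open>fdvd D p\<close>.\<close>

lemma nullstellensatz_generic_zeros:
  fixes e :: "complex ^ 'n::finite"
  assumes e: "e $ base_coord = 1" and D: "firreducible D" and f: "\<not> fdvd D f"
  obtains z where "z \<in> generic_zeros e D" "as_fun e f z \<noteq> 0"
proof -
  have D0: "degree D > 0" "D \<noteq> 0"
    using D unfolding firreducible_def by auto
  obtain u v w where w: "w \<noteq> 0" "u * D + v * f = [:w:]"
    using firreducible_bezout[OF D f] by metis
  have "w * lead_coeff D \<noteq> 0"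
    using w(1) D0(2) by simp
  then obtain y where "bval (w * lead_coeff D) y \<noteq> 0"
    using bval_nonzero by blast
  then have y: "bval w y \<noteq> 0" "bval (lead_coeff D) y \<noteq> 0"
    by auto
  have "degree D \<le> degree (specialize D y)"
    by (rule le_degree) (use y(2) in simp)
  then obtain t where t: "poly (specialize D y) t = 0"
    using alg_closed_imp_poly_has_root[of "specialize D y"] D0(1) by auto
  obtain y' where y': "\<And>p t. as_fun e p (y' + t *s e) = poly (specialize p y) t"
    using as_fun_on_line[OF e] by blast
  have "as_fun e p (y' + t *s e) = 0" if p: "fdvd D p" for p
  proof -
    obtain k s where "smult (lead_coeff D ^ k) p = D * s"
      using fdvd_lead_coeff_power[OF p D0(2)] unfolding dvd_def by metis
    then have "poly (specialize (smult (lead_coeff D ^ k) p) y) t = poly (specialize (D * s) y) t"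
      by simp
    then show ?thesis
      using t y(2) y' by (simp add: specialize_smult specialize_mult)
  qed
  then have "y' + t *s e \<in> generic_zeros e D"
    unfolding generic_zeros_def by blast
  moreover have "as_fun e f (y' + t *s e) \<noteq> 0"
  proof
    assume "as_fun e f (y' + t *s e) = 0"
    then have "poly (specialize (u * D + v * f) y) t = 0"
      using t y' by (simp add: specialize_mult specialize_add)
    then show False
      using y(1) by (simp add: w(2) specialize_const)
  qed
  ultimately show thesis
    by (rule that)
qed

lemma algebraic_setE:
  assumes "algebraic_set S" "z \<notin> S"
  obtains f where "poly_fun f" "\<And>x. x \<in> S \<Longrightarrow> f x = 0" "f z \<noteq> 0"
  using assms unfolding algebraic_set_def by blast

lemma algebraic_set_zeros: "poly_fun f \<Longrightarrow> algebraic_set {z. f z = 0}"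
  unfolding algebraic_set_def by (rule exI[of _ "{f}"]) auto

lemma generic_zeros_subset_iff:
  fixes e :: "complex ^ 'n::finite"
  assumes "e $ base_coord = 1" "firreducible D"
  shows "(\<forall>z\<in>generic_zeros e D. as_fun e f z = 0) \<longleftrightarrow> fdvd D f"
  using nullstellensatz_generic_zeros[OF assms] unfolding generic_zeros_def by blast

lemma irreducible_alg_set_generic_zeros:
  fixes e :: "complex ^ 'n::finite"
  assumes e: "e $ base_coord = 1" and D: "firreducible D"
  shows "irreducible_alg_set (generic_zeros e D)"
proof -
  note iff = generic_zeros_subset_iff[OF e D]
  have "algebraic_set (generic_zeros e D)"
    unfolding algebraic_set_def generic_zeros_def
    by (rule exI[of _ "{as_fun e p | p. fdvd D p}"]) (auto simp: poly_fun_as_fun)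
  moreover have "generic_zeros e D \<noteq> {}"
  proof
    assume "generic_zeros e D = {}"
    then have "fdvd D 1"
      using iff[of 1] by simp
    then show False
      using fdvd_degree_le[of D 1] D unfolding firreducible_def by simp
  qed
  moreover have "generic_zeros e D \<subseteq> S \<or> generic_zeros e D \<subseteq> T"
    if ST: "algebraic_set S" "algebraic_set T" "generic_zeros e D \<subseteq> S \<union> T" for S T
  proof (rule ccontr)
    assume "\<not> ?thesis"
    then obtain x y where xy: "x \<in> generic_zeros e D" "x \<notin> S" "y \<in> generic_zeros e D" "y \<notin> T"
      by blast
    obtain f where f: "poly_fun f" "\<And>z. z \<in> S \<Longrightarrow> f z = 0" "f x \<noteq> 0"
      using algebraic_setE[OF ST(1) xy(2)] by blast
    obtain g where g: "poly_fun g" "\<And>z. z \<in> T \<Longrightarrow> g z = 0" "g y \<noteq> 0"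
      using algebraic_setE[OF ST(2) xy(4)] by blast
    obtain p where p: "as_fun e p = f"
      using as_fun_surj[OF e f(1)] by blast
    obtain q where q: "as_fun e q = g"
      using as_fun_surj[OF e g(1)] by blast
    have "\<forall>z\<in>generic_zeros e D. as_fun e (p * q) z = 0"
      using ST(3) f(2) g(2) by (auto simp: as_fun_mult p q)
    then have "fdvd D p \<or> fdvd D q"
      using firreducible_prime[OF D] iff by blast
    then show False
      using iff[of p] iff[of q] p q f(3) g(3) xy by auto
  qed
  ultimately show ?thesis
    unfolding irreducible_alg_set_def by blast
qed

text \<open>In a chain of length two above \<open>generic_zeros e D\<close> the middle member would have a nonzero prime
  ideal strictly inside \<open>{p. fdvd D p}\<close>, against \<open>firreducible_height_one\<close>.\<close>

lemma irreducible_codim_generic_zeros: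
  fixes e :: "complex ^ 'n::finite"
  assumes e: "e $ base_coord = 1" and D: "firreducible D"
  shows "irreducible_codim (generic_zeros e D) \<le> 1"
proof -
  let ?Y = "generic_zeros e D"
  note iff = generic_zeros_subset_iff[OF e D]
  have "m \<le> 1" if C: "C 0 = ?Y" "\<forall>j\<le>m. irreducible_alg_set (C j)" "\<forall>j<m. C j \<subset> C (Suc j)" for m C
  proof (rule ccontr)
    assume m: "\<not> m \<le> 1"
    have C1: "irreducible_alg_set (C 1)" and YC: "?Y \<subset> C 1"
      and C2: "C 1 \<subset> C 2"
      using C(2)[rule_format, of 1] C(3)[rule_format, of 0] C(3)[rule_format, of 1] C(1) m
      by (auto simp: numeral_2_eq_2)
    have alg: "algebraic_set (C 1)"
      using C1 unfolding irreducible_alg_set_def by blast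
    define Q where "Q = {p. \<forall>z\<in>C 1. as_fun e p z = 0}"
    have prime: "f \<in> Q \<or> g \<in> Q" if "f * g \<in> Q" for f g
    proof -
      have "C 1 \<subseteq> {z. as_fun e f z = 0} \<union> {z. as_fun e g z = 0}"
        using that unfolding Q_def by (auto simp: as_fun_mult)
      then have "C 1 \<subseteq> {z. as_fun e f z = 0} \<or> C 1 \<subseteq> {z. as_fun e g z = 0}"
        using C1 algebraic_set_zeros[OF poly_fun_as_fun] unfolding irreducible_alg_set_def
        by blast
      then show ?thesis
        unfolding Q_def by blast
    qed
    obtain x where "x \<notin> C 1"
      using C2 by blast
    then obtain f where f: "poly_fun f" "\<And>z. z \<in> C 1 \<Longrightarrow> f z = 0" "f x \<noteq> 0"
      using algebraic_setE[OF alg] by metis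
    then obtain f0 where f0: "as_fun e f0 = f"
      using as_fun_surj[OF e] by metis
    have f0Q: "f0 \<in> Q"
      using f(2) f0 unfolding Q_def by blast
    have "f0 \<noteq> 0"
      using f(3) unfolding f0[symmetric] as_fun_def specialize_def by auto
    have sub: "fdvd D p" if "p \<in> Q" for p
      using that YC iff[of p] unfolding Q_def by blast
    have mult: "u * p \<in> Q" if "p \<in> Q" for u p
      using that unfolding Q_def by (auto simp: as_fun_mult)
    have "C 1 \<subseteq> ?Y"
      using firreducible_height_one[OF D mult prime sub f0Q \<open>f0 \<noteq> 0\<close>]
      unfolding generic_zeros_def Q_def by blast
    with YC show False
      by blast
  qed
  then show ?thesis
    unfolding irreducible_codim_def by (intro Sup_least) (auto simp: one_enat_def)
qed

text \<open>Otherwise a generator over \<open>K\<close> of the ideal of the \<open>a j\<close> has positive degree, and the generic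
  zeros of an irreducible factor are common zeros of codimension at most one.\<close>

lemma codim_ge_2_bezout:
  fixes e :: "complex ^ 'n::finite" and a :: "'i::finite \<Rightarrow> 'n base poly"
  assumes e: "e $ base_coord = 1" and nz: "a j0 \<noteq> 0"
    and codim: "codim {z. \<forall>j. as_fun e (a j) z = 0} \<ge> 2"
  obtains u w where "w \<noteq> 0" "(\<Sum>j\<in>UNIV. u j * a j) = [:w:]"
proof -
  define I where "I = {\<Sum>j\<in>UNIV. u j * a j | u. True}"
  have add: "f + g \<in> I" if "f \<in> I" "g \<in> I" for f g
  proof -
    obtain u v where "f = (\<Sum>j\<in>UNIV. u j * a j)" "g = (\<Sum>j\<in>UNIV. v j * a j)"
      using \<open>f \<in> I\<close> \<open>g \<in> I\<close> unfolding I_def by blast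
    then have "f + g = (\<Sum>j\<in>UNIV. (u j + v j) * a j)"
      by (simp add: sum.distrib distrib_right)
    then show ?thesis
      unfolding I_def by (intro CollectI exI[of _ "\<lambda>j. u j + v j"]) simp
  qed
  have mult: "s * f \<in> I" if "f \<in> I" for s f
  proof -
    obtain u where "f = (\<Sum>j\<in>UNIV. u j * a j)"
      using \<open>f \<in> I\<close> unfolding I_def by blast
    then have "s * f = (\<Sum>j\<in>UNIV. (s * u j) * a j)"
      by (simp add: sum_distrib_left mult.assoc)
    then show ?thesis
      unfolding I_def by (intro CollectI exI[of _ "\<lambda>j. s * u j"]) simp
  qed
  have aI: "a i \<in> I" for i
  proof -
    have "a i = (\<Sum>j\<in>UNIV. (if j = i then 1 else 0) * a j)"
      by (simp add: if_distrib[of "\<lambda>x. x * _"] cong: if_cong)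
    then show ?thesis
      unfolding I_def by (intro CollectI exI[of _ "\<lambda>j. if j = i then 1 else 0"] conjI TrueI)
  qed
  obtain G where G: "G \<in> I" "G \<noteq> 0" and div: "\<And>g. g \<in> I \<Longrightarrow> fdvd G g"
    using ideal_fraction_generator[OF add mult aI nz] by metis
  have "degree G = 0"
  proof (rule ccontr)
    assume "degree G \<noteq> 0"
    then obtain D where D: "firreducible D" "fdvd D G"
      using firreducible_factor_exists[of G] by auto
    have "fdvd D (a j)" for j
      by (rule fdvd_trans[OF D(2) div[OF aI]])
    then have "generic_zeros e D \<subseteq> {z. \<forall>j. as_fun e (a j) z = 0}"
      unfolding generic_zeros_def by blast
    then have "codim {z. \<forall>j. as_fun e (a j) z = 0} \<le> irreducible_codim (generic_zeros e D)"
      unfolding codim_def using irreducible_alg_set_generic_zeros[OF e D(1)]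
      by (intro Inf_lower) blast
    also have "\<dots> \<le> 1"
      by (rule irreducible_codim_generic_zeros[OF e D(1)])
    finally have "(2 :: enat) \<le> 1"
      using codim by (rule order_trans[rotated])
    then show False
      by simp
  qed
  then obtain w where w: "G = [:w:]"
    using degree_eq_zeroE by blast
  then have "w \<noteq> 0"
    using G(2) by auto
  then show thesis
    using that G(1) w unfolding I_def by blast
qed

section \<open>Proportional homogeneous vectors of polynomials\<close>

text \<open>The specializations of \<open>p\<close> are the restrictions of \<open>f\<close> to the lines in the direction \<open>e\<close>, and
  \<open>homogeneous_on_line\<close> bounds them uniformly.\<close>

lemma as_fun_homogeneous_coeffs:
  fixes e :: "complex ^ 'n::finite"
  assumes e: "e $ base_coord = 1"
    and p: "as_fun e p = f" and hom: "\<And>t z. f (t *s z) = t ^ d * f z"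
  shows "degree p \<le> d" "bval (coeff p d) y = f e"
proof -
  have line: "degree (specialize p y) \<le> d" "coeff (specialize p y) d = f e" for y
  proof -
    obtain y' where y': "\<And>p t. as_fun e p (y' + t *s e) = poly (specialize p y) t"
      using as_fun_on_line[OF e] by blast
    have f: "poly_fun f"
      using poly_fun_as_fun p by metis
    have "f (y' + t *s e) = poly (specialize p y) t" for t
      using y' p by metis
    then show "degree (specialize p y) \<le> d" "coeff (specialize p y) d = f e"
      using homogeneous_on_line[OF f hom] by blast+
  qed
  show "bval (coeff p d) y = f e"
    using line(2) by simp
  have "coeff p k = 0" if "k > d" for k
  proof (rule bval_eqI)
    fix y
    show "bval (coeff p k) y = bval 0 y"
      using line(1)[of y] that by (metis bval_0 coeff_eq_0 coeff_specialize order_le_less_trans)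
  qed
  then show "degree p \<le> d"
    by (intro degree_le) blast
qed

text \<open>This is the only place where the codimension of the singular set enters.  The direction \<open>e\<close> of
  the distinguished coordinate is chosen with \<open>A e $ k0 \<noteq> 0\<close>, so that \<open>A\<^bsub>k0\<^esub>\<close> has degree exactly \<open>d\<close>
  in it with a constant leading coefficient.  From \<open>\<Sum> u\<^sub>j a\<^sub>j = w\<close> the proportionality gives
  \<open>w h\<^bsub>k0\<^esub> = a\<^bsub>k0\<^esub> b\<close>, and both claims follow by comparing degrees and leading coefficients.\<close>

lemma proportional_homogeneous:
  fixes A H :: "complex ^ 'n::finite \<Rightarrow> complex ^ 'n"
  assumes polyA: "\<And>k. poly_fun (\<lambda>z. A z $ k)" and homA: "\<And>t z. A (t *s z) = t ^ d *s A z"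
    and codim: "codim {z. \<forall>k. A z $ k = 0} \<ge> 2" and A0: "A z0 \<noteq> 0"
    and polyH: "\<And>k. poly_fun (\<lambda>z. H z $ k)" and homH: "\<And>t z. H (t *s z) = t ^ m *s H z"
    and rel: "\<And>z j k. H z $ j * A z $ k = H z $ k * A z $ j"
  shows "H z1 \<noteq> 0 \<Longrightarrow> d \<le> m" and "m = d \<Longrightarrow> \<exists>c. \<forall>z. H z = c *s A z"
proof -
  obtain k0 where "A z0 $ k0 \<noteq> 0"
    using A0 by (auto simp: vec_eq_iff)
  moreover have "(axis base_coord 1 :: complex ^ 'n) $ base_coord \<noteq> 0"
    by simp
  ultimately obtain z2 where z2: "A z2 $ k0 \<noteq> 0" "z2 $ base_coord \<noteq> 0"
    using poly_fun_integral_domain[OF polyA poly_fun_coord] by metis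
  define e where "e = inverse (z2 $ base_coord) *s z2"
  have e: "e $ base_coord = 1" and Ae: "A e $ k0 \<noteq> 0"
    using z2 by (simp_all add: e_def homA)
  have "\<forall>k. \<exists>p. as_fun e p = (\<lambda>z. A z $ k)" "\<forall>k. \<exists>p. as_fun e p = (\<lambda>z. H z $ k)"
    using as_fun_surj[OF e polyA] as_fun_surj[OF e polyH] by metis+
  then obtain a h where a: "\<And>k. as_fun e (a k) = (\<lambda>z. A z $ k)"
    and h: "\<And>k. as_fun e (h k) = (\<lambda>z. H z $ k)"
    by metis
  have rel': "h j * a k = h k * a j" for j k
    by (rule as_fun_inj[OF e]) (simp add: as_fun_mult a h rel)
  have ak0: "a k0 \<noteq> 0"
    using Ae fun_cong[OF a, of k0 e] by (auto simp: as_fun_def specialize_def)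
  have "2 \<le> codim {z. \<forall>k. as_fun e (a k) z = 0}"
    using codim by (simp only: a)
  then obtain u w where w: "w \<noteq> 0" and u: "(\<Sum>j\<in>UNIV. u j * a j) = [:w:]"
    using codim_ge_2_bezout[of e a k0, OF e ak0] by metis
  define b where "b = (\<Sum>j\<in>UNIV. u j * h j)"
  have "h k0 * (\<Sum>j\<in>UNIV. u j * a j) = (\<Sum>j\<in>UNIV. u j * (h k0 * a j))"
    by (simp add: sum_distrib_left mult_ac)
  also have "\<dots> = (\<Sum>j\<in>UNIV. u j * (h j * a k0))"
    by (simp only: rel')
  also have "\<dots> = a k0 * b"
    unfolding b_def by (simp add: sum_distrib_left mult_ac)
  finally have wh: "smult w (h k0) = a k0 * b"
    unfolding u by simp
  have homA': "A (t *s z) $ k = t ^ d * A z $ k" and homH': "H (t *s z) $ k = t ^ m * H z $ k" for t z k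
    by (simp_all add: homA homH)
  note coeffA = as_fun_homogeneous_coeffs[OF e a homA', of k0]
  note coeffH = as_fun_homogeneous_coeffs[OF e h homH', of k0]
  have "coeff (a k0) d \<noteq> 0"
    using coeffA(2) Ae by (metis bval_0)
  then have degA: "degree (a k0) = d"
    using coeffA(1) le_degree by (metis order_antisym)
  have deg: "degree (h k0) = d + degree b" if "h k0 \<noteq> 0"
  proof -
    have "a k0 * b \<noteq> 0"
      using wh w that by (metis smult_eq_0_iff)
    then have "degree (a k0 * b) = d + degree b"
      using degA by (subst degree_mult_eq) auto
    then show ?thesis
      using wh w by (metis degree_smult_eq)
  qed
  have Hj: "H z $ j = c * A z $ j" if c: "\<And>z. H z $ k0 = c * A z $ k0" for c z j
  proof -
    have "H z $ j - c * A z $ j = 0"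
    proof (rule poly_fun_vanishing_extends[where g = "\<lambda>z. H z $ j - c * A z $ j", OF _ polyA Ae])
      show "poly_fun (\<lambda>z. H z $ j - c * A z $ j)"
        by (intro poly_fun_diff poly_fun_mult poly_fun_const polyA polyH)
      show "H z $ j - c * A z $ j = 0" if "A z $ k0 \<noteq> 0" for z
        using rel[of z j k0] c[of z] that by (auto simp: algebra_simps)
    qed
    then show ?thesis
      by simp
  qed
  show "d \<le> m" if "H z1 \<noteq> 0"
  proof -
    have "h k0 \<noteq> 0"
    proof
      assume "h k0 = 0"
      then have "H z $ k0 = 0 * A z $ k0" for z
        using fun_cong[OF h, of k0 z] by (simp add: as_fun_def specialize_def)
      then have "H z1 = 0"
        using Hj[of 0] by (simp add: vec_eq_iff)
      with that show False ..
    qed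
    then show ?thesis
      using deg coeffH(1) by simp
  qed
  show "\<exists>c. \<forall>z. H z = c *s A z" if "m = d"
  proof -
    define c where "c = H e $ k0 / A e $ k0"
    have "H z $ k0 = c * A z $ k0" for z
    proof (cases "h k0 = 0")
      case True
      then have "H z $ k0 = 0" for z
        using fun_cong[OF h, of k0 z] by (simp add: as_fun_def specialize_def)
      then show ?thesis
        by (simp add: c_def)
    next
      case False
      then have "degree b = 0"
        using deg coeffH(1) that by simp
      then obtain b0 where b0: "b = [:b0:]"
        using degree_eq_zeroE by blast
      have wh0: "smult w (h k0) = smult b0 (a k0)"
        using wh b0 by simp
      have bw: "bval b0 y = c * bval w y" for y
      proof -
        have "w * coeff (h k0) d = b0 * coeff (a k0) d"
          using wh0 by (metis coeff_smult)
        then have "bval w y * H e $ k0 = bval b0 y * A e $ k0"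
          using coeffA(2)[of y] coeffH(2)[of y] that by (metis bval_mult)
        then show ?thesis
          using Ae by (simp add: c_def field_simps)
      qed
      obtain y where "bval w y \<noteq> 0"
        using bval_nonzero[OF w] by blast
      moreover obtain y' where "\<And>p t. as_fun e p (y' + t *s e) = poly (specialize p y) t"
        using as_fun_on_line[OF e] by blast
      ultimately have wy: "as_fun e [:w:] (y' + 0 *s e) \<noteq> 0"
        by (metis specialize_const poly_pCons poly_0 add.right_neutral mult_zero_right)
      have "H z $ k0 - c * A z $ k0 = 0"
      proof (rule poly_fun_vanishing_extends[where g = "\<lambda>z. H z $ k0 - c * A z $ k0",
            OF _ poly_fun_as_fun wy])
        show "poly_fun (\<lambda>z. H z $ k0 - c * A z $ k0)"
          by (intro poly_fun_diff poly_fun_mult poly_fun_const polyA polyH)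
        show "H z $ k0 - c * A z $ k0 = 0" if "as_fun e [:w:] z \<noteq> 0" for z
        proof -
          have "as_fun e ([:w:] * h k0) z = as_fun e ([:b0:] * a k0) z"
            using wh0 by simp
          then have "as_fun e [:w:] z * H z $ k0 = as_fun e [:b0:] z * A z $ k0"
            by (simp only: as_fun_mult a h)
          also have "as_fun e [:b0:] z = c * as_fun e [:w:] z"
            by (simp only: as_fun_const bw)
          finally show ?thesis
            using that by simp
        qed
      qed
      then show ?thesis
        by simp
    qed
    then have "H z $ j = c * A z $ j" for z j
      by (rule Hj)
    then show ?thesis
      by (intro exI[of _ c]) (simp add: vec_eq_iff)
  qed
qed

section \<open>Holomorphic vector fields on projective space are linear\<close>

lemma dir_deriv_chart_change:
  assumes "x $ j \<noteq> 0"
  shows "dir_deriv (chart_change j) x v = inverse (x $ j) *s v - (v $ j / (x $ j)\<^sup>2) *s x"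
proof (rule vec_eq_iff[THEN iffD2, rule_format])
  fix k
  have "((\<lambda>t. inverse (x $ j + t * v $ j) * (x $ k + t * v $ k)) has_field_derivative
      (inverse (x $ j) * v $ k - v $ j / (x $ j)\<^sup>2 * x $ k)) (at 0)"
    using assms by (auto intro!: derivative_eq_intros simp: field_simps power2_eq_square)
  then show "dir_deriv (chart_change j) x v $ k =
      (inverse (x $ j) *s v - (v $ j / (x $ j)\<^sup>2) *s x) $ k"
    unfolding dir_deriv_def chart_change_def vec_lambda_beta vector_add_component
      vector_smult_component vector_minus_component
    by (rule DERIV_imp_deriv)
qed

lemma vfield_transition:
  assumes X: "X \<in> hol_vfields" and x: "x \<in> chart i" "x $ j \<noteq> 0"
  shows "X j (inverse (x $ j) *s x) = inverse (x $ j) *s X i x - (X i x $ j / (x $ j)\<^sup>2) *s x"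
proof -
  have "X j (chart_change j x) = dir_deriv (chart_change j) x (X i x)"
    using X x unfolding hol_vfields_def by blast
  then show ?thesis
    unfolding dir_deriv_chart_change[OF x(2)] chart_change_def .
qed

lemma has_field_derivative_on_chart_line:
  fixes F :: "complex ^ 'n::finite \<Rightarrow> complex ^ 'n"
  assumes F: "chart_holomorphic i F" and x: "x \<in> chart i"
  obtains M :: "complex ^ 'n ^ 'n" where
    "\<And>v k. v $ i = 0 \<Longrightarrow> ((\<lambda>t. F (x + t *s v) $ k) has_field_derivative (M *v v) $ k) (at 0)"
proof -
  obtain D where lin: "Vector_Spaces.linear (*s) (*s) D"
    and D: "(F has_derivative D) (at x within chart i)"
    using F x unfolding chart_holomorphic_def by blast
  have "((\<lambda>t. F (x + t *s v) $ k) has_field_derivative (matrix D *v v) $ k) (at 0)"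
    if v: "v $ i = 0" for v k
  proof -
    have "linear (\<lambda>h :: complex. h *s v)"
      by (rule linearI) (simp_all add: vec_eq_iff algebra_simps)
    then have "((\<lambda>h. h *s v) has_derivative (\<lambda>h. h *s v)) (at 0)"
      by (simp add: linear_conv_bounded_linear bounded_linear_imp_has_derivative)
    then have g: "((\<lambda>t. x + t *s v) has_derivative (\<lambda>h. h *s v)) (at 0)"
      using has_derivative_add[OF has_derivative_const[of x]] by fastforce
    have "(F has_derivative D) (at (x + 0 *s v) within (\<lambda>t. x + t *s v) ` UNIV)"
      using has_derivative_subset[OF D] x v by (simp add: image_subset_iff chart_def)
    from diff_chain_within[OF g this]
    have "((\<lambda>t. F (x + t *s v)) has_derivative (\<lambda>h. D (h *s v))) (at 0)"
      by (simp add: o_def)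
    then have "((\<lambda>t. F (x + t *s v) $ k) has_derivative (\<lambda>h. D (h *s v) $ k)) (at 0)"
      by (rule bounded_linear.has_derivative[OF bounded_linear_vec_nth])
    moreover have "D (h *s v) $ k = (matrix D *v v) $ k * h" for h
      using vec.linear_scale[OF lin] matrix_works[OF lin] by (simp add: mult.commute)
    ultimately show ?thesis
      unfolding has_field_derivative_def by simp
  qed
  then show thesis
    by (rule that)
qed

lemma entire_quadratic:
  fixes f :: "complex \<Rightarrow> complex"
  assumes hol: "f holomorphic_on UNIV" and lim: "((\<lambda>t. f t / t\<^sup>2) \<longlongrightarrow> c) at_infinity"
  shows "f t = f 0 + deriv f 0 * t + c * t\<^sup>2"
proof -
  have "\<forall>\<^sub>F t in at_infinity. dist (f t / t\<^sup>2) c < 1"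
    using lim tendstoD zero_less_one by blast
  then obtain b where b: "\<And>t. norm t \<ge> b \<Longrightarrow> dist (f t / t\<^sup>2) c < 1"
    unfolding eventually_at_infinity by blast
  have "norm (f t) \<le> (norm c + 1) * norm t ^ 2" if "norm t \<ge> max b 1" for t
  proof -
    have "t \<noteq> 0"
      using that by auto
    have "norm (f t / t\<^sup>2) \<le> norm c + 1"
      using b[of t] that norm_triangle_ineq2[of "f t / t\<^sup>2" c] by (auto simp: dist_norm)
    then show ?thesis
      using \<open>t \<noteq> 0\<close> by (simp add: norm_divide norm_power field_simps)
  qed
  then have f: "f t = (\<Sum>k\<le>2. (deriv ^^ k) f 0 / fact k * t ^ k)" for t
    by (rule Liouville_polynomial[OF hol])
  define a where "a = (deriv ^^ 2) f 0 / fact 2"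
  have ft: "f t = f 0 + deriv f 0 * t + a * t\<^sup>2" for t
    using f[of t] by (simp add: a_def numeral_2_eq_2)
  have "((\<lambda>t. f 0 * inverse t * inverse t + deriv f 0 * inverse t + a) \<longlongrightarrow>
      f 0 * 0 * 0 + deriv f 0 * 0 + a) at_infinity"
    by (intro tendsto_intros tendsto_inverse_0)
  moreover have "\<forall>\<^sub>F t in at_infinity. f 0 * inverse t * inverse t + deriv f 0 * inverse t + a = f t / t\<^sup>2"
    using eventually_not_equal_at_infinity[of 0]
  proof eventually_elim
    case (elim t)
    then show ?case
      by (subst ft) (simp add: field_simps power2_eq_square)
  qed
  ultimately have "((\<lambda>t. f t / t\<^sup>2) \<longlongrightarrow> a) at_infinity"
    by (simp add: tendsto_cong)
  then have "a = c"
    using lim tendsto_unique trivial_limit_at_infinity by blast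
  then show ?thesis
    unfolding ft[of t] by simp
qed

lemma hol_vfieldsD:
  assumes "X \<in> hol_vfields"
  shows "x \<in> chart i \<Longrightarrow> X i x $ i = 0" "x \<notin> chart i \<Longrightarrow> X i x = 0" "chart_holomorphic i (X i)"
  using assms unfolding hol_vfields_def by blast+

lemma holomorphic_on_chart_line:
  assumes F: "chart_holomorphic i F" and x: "x \<in> chart i" and v: "v $ i = 0"
  shows "(\<lambda>t. F (x + t *s v) $ k) holomorphic_on UNIV"
  unfolding holomorphic_on_def field_differentiable_def
proof safe
  fix t :: complex
  have "x + t *s v \<in> chart i"
    using x v by (simp add: chart_def)
  then obtain M where "((\<lambda>s. F (x + t *s v + s *s v) $ k) has_field_derivative (M *v v) $ k) (at 0)"
    using has_field_derivative_on_chart_line[OF F] v by metis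
  moreover have "x + t *s v + s *s v = x + (s + t) *s v" for s
    by (simp add: vec_eq_iff algebra_simps)
  ultimately have "((\<lambda>s. F (x + s *s v) $ k) has_field_derivative (M *v v) $ k) (at t)"
    using DERIV_shift[of "\<lambda>s. F (x + s *s v) $ k" _ 0 t] by simp
  then show "\<exists>f'. ((\<lambda>t. F (x + t *s v) $ k) has_field_derivative f') (at t)"
    by blast
qed

text \<open>On a line through the origin of the chart a vector field has at most quadratic growth: the
  line runs into a point \<open>p\<close> of another chart, where the field is continuous, and the transition
  map contributes the square.\<close>

lemma vfield_on_line:
  fixes X :: "'n::finite vfield"
  assumes X: "X \<in> hol_vfields" and v: "v $ i = 0" "v $ j \<noteq> 0"
    and M: "((\<lambda>t. X i (axis i 1 + t *s v) $ k) has_field_derivative (M *v v) $ k) (at 0)"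
  shows "X i (axis i 1 + v) $ k =
    X i (axis i 1) $ k + (M *v v) $ k - v $ j * X j (inverse (v $ j) *s v) $ i * v $ k"
proof -
  define p where "p = inverse (v $ j) *s v"
  define f where "f t = X i (axis i 1 + t *s v) $ k" for t
  \<comment> \<open>the point \<open>axis i 1 + t v\<close> of the line, seen in the chart \<open>j\<close>\<close>
  define y where "y t = inverse (v $ j) *s (inverse t *s axis i 1 + v)" for t
  have "i \<noteq> j"
    using v by auto
  have axis: "axis i 1 \<in> chart i"
    by (simp add: chart_def)
  have chart_p: "p \<in> chart j"
    using v by (simp add: p_def chart_def)
  obtain D where D: "(X j has_derivative D) (at p within chart j)"
    using hol_vfieldsD(3)[OF X] chart_p unfolding chart_holomorphic_def by blast
  have "(y \<longlongrightarrow> inverse (v $ j) *s (0 *s axis i 1 + v)) at_infinity"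
    unfolding y_def
    by (intro vec_tendstoI)
      (simp only: vector_add_component vector_smult_component,
        intro tendsto_add tendsto_mult tendsto_const tendsto_inverse_0)
  then have yp: "(y \<longlongrightarrow> p) at_infinity"
    by (simp add: p_def)
  have "\<forall>\<^sub>F t in at_infinity. y t \<in> chart j"
    using \<open>i \<noteq> j\<close> v by (simp add: y_def chart_def axis_def)
  then have "((\<lambda>t. X j (y t)) \<longlongrightarrow> X j p) at_infinity"
    using continuous_within_tendsto_compose[OF has_derivative_continuous[OF D] _ yp] by blast
  then have Xy: "((\<lambda>t. X j (y t) $ m) \<longlongrightarrow> X j p $ m) at_infinity" for m
    by (rule tendsto_vec_nth)
  have "((\<lambda>t. v $ j * (inverse t * X j (y t) $ k - X j (y t) $ i * (inverse t * axis i 1 $ k + v $ k)))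
      \<longlongrightarrow> v $ j * (0 * X j p $ k - X j p $ i * (0 * axis i 1 $ k + v $ k))) at_infinity"
    by (intro tendsto_intros tendsto_inverse_0 Xy)
  moreover have "\<forall>\<^sub>F t in at_infinity.
      v $ j * (inverse t * X j (y t) $ k - X j (y t) $ i * (inverse t * axis i 1 $ k + v $ k)) = f t / t\<^sup>2"
    using eventually_not_equal_at_infinity[of 0]
  proof eventually_elim
    case (elim t)
    define x where "x = axis i 1 + t *s v"
    have x: "x \<in> chart i" "x $ i = 1"
      using v by (simp_all add: x_def chart_def)
    have xj: "x $ j = t * v $ j"
      using \<open>i \<noteq> j\<close> by (simp add: x_def axis_def)
    then have xj0: "x $ j \<noteq> 0"
      using elim v by simp
    have "inverse (x $ j) *s x = y t"
      unfolding xj using elim by (simp add: x_def y_def vec_eq_iff field_simps)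
    then have tr: "X j (y t) = inverse (x $ j) *s X i x - (X i x $ j / (x $ j)\<^sup>2) *s x"
      using vfield_transition[OF X x(1) xj0] by simp
    then have "X j (y t) $ i = - (X i x $ j / (x $ j)\<^sup>2)"
      using x hol_vfieldsD(1)[OF X x(1)] by simp
    then have "X j (y t) $ k = inverse (x $ j) * X i x $ k + X j (y t) $ i * x $ k"
      using tr by simp
    then have "X i x $ k = x $ j * (X j (y t) $ k - X j (y t) $ i * x $ k)"
      using xj0 by (simp add: field_simps)
    then have ft: "f t = t * v $ j * (X j (y t) $ k - X j (y t) $ i * (axis i 1 $ k + t * v $ k))"
      unfolding f_def x_def[symmetric] by (simp only: xj) (simp add: x_def)
    show ?case
      unfolding ft using elim by (simp add: field_simps power2_eq_square)
  qed
  ultimately have "((\<lambda>t. f t / t\<^sup>2) \<longlongrightarrow> - (v $ j * X j p $ i * v $ k)) at_infinity"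
    by (simp add: tendsto_cong mult.assoc)
  moreover have "f holomorphic_on UNIV"
    unfolding f_def using holomorphic_on_chart_line[OF hol_vfieldsD(3)[OF X] axis v(1)] .
  ultimately have "f 1 = f 0 + deriv f 0 * 1 + - (v $ j * X j p $ i * v $ k) * 1\<^sup>2"
    by (rule entire_quadratic[rotated])
  moreover have "deriv f 0 = (M *v v) $ k"
    unfolding f_def by (rule DERIV_imp_deriv[OF M])
  ultimately show ?thesis
    by (simp add: f_def p_def)
qed

text \<open>By \<open>vfield_on_line\<close>, in the chart \<open>i\<close> the field is \<open>a + A v - \<lambda>(v) v\<close> at the point \<open>axis i 1 + v\<close>,
  where \<open>\<lambda>(v) = v\<^sub>j X\<^sub>j(v / v\<^sub>j)\<^sub>i\<close>.  The same formula in the chart \<open>j\<close>, restricted to the hyperplane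
  where the coordinate \<open>i\<close> vanishes, has no quadratic part in its component \<open>i\<close>; so \<open>\<lambda>\<close> is linear
  where \<open>v\<^sub>j \<noteq> 0\<close>, and everywhere by continuity.\<close>

lemma vfield_linear:
  fixes X :: "'n::finite vfield"
  assumes X: "X \<in> hol_vfields" and card: "CARD('n) \<ge> 2"
  obtains M :: "complex ^ 'n ^ 'n" where
    "\<And>x. x \<in> chart i \<Longrightarrow> X i x = M *v x - (M *v x) $ i *s x"
proof -
  have "UNIV \<noteq> {i}"
  proof
    assume "UNIV = {i}"
    then have "CARD('n) = card {i}"
      by (rule arg_cong)
    with card show False
      by simp
  qed
  then obtain j where ji: "j \<noteq> i"
    by blast
  have axis: "axis l 1 \<in> chart l" for l :: 'n
    by (simp add: chart_def)
  obtain A where A: "\<And>v k. v $ i = 0 \<Longrightarrow>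
      ((\<lambda>t. X i (axis i 1 + t *s v) $ k) has_field_derivative (A *v v) $ k) (at 0)"
    using has_field_derivative_on_chart_line[OF hol_vfieldsD(3)[OF X] axis] by blast
  obtain B where B: "\<And>v k. v $ j = 0 \<Longrightarrow>
      ((\<lambda>t. X j (axis j 1 + t *s v) $ k) has_field_derivative (B *v v) $ k) (at 0)"
    using has_field_derivative_on_chart_line[OF hol_vfieldsD(3)[OF X] axis] by blast
  define a where "a = X i (axis i 1)"
  define b where "b = X j (axis j 1)"
  define l where "l v = v $ j * b $ i + (B *v (v - v $ j *s axis j 1)) $ i" for v
  have scale: "C *v (c *s u) = c *s (C *v u)" for C :: "complex ^ 'n ^ 'n" and c u
    by (rule vec.linear_scale[OF matrix_vector_mul_linear_gen])
  have Xj: "X j (axis j 1 + w) $ i = b $ i + (B *v w) $ i" if w: "w $ i = 0" "w $ j = 0" for w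
  proof (cases "w = 0")
    case True
    then show ?thesis
      by (simp add: b_def)
  next
    case False
    then obtain m where m: "w $ m \<noteq> 0"
      by (auto simp: vec_eq_iff)
    show ?thesis
      using vfield_on_line[OF X w(2) m B[OF w(2), of i]] w(1) by (simp add: b_def)
  qed
  have generic: "X i (axis i 1 + v) $ k = a $ k + (A *v v) $ k - l v * v $ k"
    if v: "v $ i = 0" "v $ j \<noteq> 0" for v k
  proof -
    define w where "w = inverse (v $ j) *s (v - v $ j *s axis j 1)"
    have w: "w $ i = 0" "w $ j = 0"
      using v ji by (simp_all add: w_def axis_def)
    have "inverse (v $ j) *s v = axis j 1 + w"
      using v by (simp add: w_def vec_eq_iff field_simps)
    then have "v $ j * X j (inverse (v $ j) *s v) $ i = v $ j * (b $ i + (B *v w) $ i)"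
      using Xj[OF w] by simp
    also have "\<dots> = l v"
      unfolding w_def l_def scale vector_smult_component
      using v(2) by (simp add: distrib_left flip: mult.assoc)
    finally have lv: "v $ j * X j (inverse (v $ j) *s v) $ i = l v" .
    show ?thesis
      using vfield_on_line[OF X v A[OF v(1), of k]] unfolding lv a_def .
  qed
  have line: "X i (axis i 1 + v) $ k = a $ k + (A *v v) $ k - l v * v $ k"
    if v: "v $ i = 0" for v k
  proof (cases "v $ j = 0")
    case False
    then show ?thesis
      using generic v by blast
  next
    case True
    let ?u = "axis j 1 :: complex ^ 'n"
    have "axis i 1 + v \<in> chart i" "?u $ i = 0"
      using v ji by (simp_all add: chart_def axis_def)
    then obtain C where "((\<lambda>t. X i (axis i 1 + v + t *s ?u) $ k) has_field_derivative (C *v ?u) $ k) (at 0)"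
      using has_field_derivative_on_chart_line[OF hol_vfieldsD(3)[OF X]] by metis
    then have "isCont (\<lambda>t. X i (axis i 1 + v + t *s ?u) $ k) 0"
      by (rule DERIV_isCont)
    then have lim: "((\<lambda>t. X i (axis i 1 + v + t *s ?u) $ k) \<longlongrightarrow> X i (axis i 1 + v) $ k) (at 0)"
      by (simp add: isCont_def)
    have "((\<lambda>t. a $ k + ((A *v v) $ k + t * (A *v ?u) $ k) - (t * b $ i + (B *v v) $ i) * (v $ k + t * ?u $ k))
        \<longlongrightarrow> a $ k + ((A *v v) $ k + 0 * (A *v ?u) $ k) - (0 * b $ i + (B *v v) $ i) * (v $ k + 0 * ?u $ k)) (at 0)"
      by (intro tendsto_intros)
    moreover have "\<forall>\<^sub>F t in at 0. a $ k + ((A *v v) $ k + t * (A *v ?u) $ k)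
        - (t * b $ i + (B *v v) $ i) * (v $ k + t * ?u $ k) = X i (axis i 1 + v + t *s ?u) $ k"
      using eventually_neq_at_within[of 0]
    proof eventually_elim
      case (elim t)
      have vt: "(v + t *s ?u) $ i = 0" "(v + t *s ?u) $ j \<noteq> 0"
        using v True ji elim by (simp_all add: axis_def)
      have "l (v + t *s ?u) = t * b $ i + (B *v v) $ i"
        using True by (simp add: l_def)
      then show ?case
        using generic[OF vt, of k] by (simp add: matrix_vector_right_distrib scale add.assoc)
    qed
    ultimately have "((\<lambda>t. X i (axis i 1 + v + t *s ?u) $ k) \<longlongrightarrow>
        a $ k + (A *v v) $ k - l v * v $ k) (at 0)"
      using True by (simp add: tendsto_cong l_def)
    then show ?thesis
      using tendsto_unique[OF _ lim] by simp
  qed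
  \<comment> \<open>The linear field whose \<open>i\<close>-th component is \<open>l\<close> on the directions of the chart.\<close>
  define T where "T z = z $ i *s a + A *v (z - z $ i *s axis i 1) + l (z - z $ i *s axis i 1) *s axis i 1" for z
  have "Vector_Spaces.linear (*s) (*s) T"
  proof -
    have l_add: "l (u + v) = l u + l v" for u v
    proof -
      have "u + v - (u + v) $ j *s axis j 1 = (u - u $ j *s axis j 1) + (v - v $ j *s axis j 1)"
        by (simp add: vec_eq_iff algebra_simps)
      then show ?thesis
        unfolding l_def by (simp only: matrix_vector_right_distrib) (simp add: algebra_simps)
    qed
    have l_scale: "l (c *s v) = c * l v" for c v
    proof -
      have "c *s v - (c *s v) $ j *s axis j 1 = c *s (v - v $ j *s axis j 1)"
        by (simp add: vec_eq_iff algebra_simps)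
      then show ?thesis
        unfolding l_def by (simp only: scale) (simp add: algebra_simps)
    qed
    have "T (u + v) = T u + T v" for u v
    proof -
      have "u + v - (u + v) $ i *s axis i 1 = (u - u $ i *s axis i 1) + (v - v $ i *s axis i 1)"
        by (simp add: vec_eq_iff algebra_simps)
      then show ?thesis
        unfolding T_def by (simp only: matrix_vector_right_distrib l_add) (simp add: vec_eq_iff algebra_simps)
    qed
    moreover have "T (c *s v) = c *s T v" for c v
    proof -
      have "c *s v - (c *s v) $ i *s axis i 1 = c *s (v - v $ i *s axis i 1)"
        by (simp add: vec_eq_iff algebra_simps)
      then show ?thesis
        unfolding T_def by (simp only: scale l_scale) (simp add: vec_eq_iff algebra_simps)
    qed
    ultimately show ?thesis
      unfolding Vector_Spaces.linear_iff by (simp add: vec.vector_space_axioms)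
  qed
  then have T: "matrix T *v z = T z" for z
    by (rule matrix_works)
  have "X i x = matrix T *v x - (matrix T *v x) $ i *s x" if x: "x \<in> chart i" for x
  proof -
    define v where "v = x - axis i 1"
    have xi: "x $ i = 1"
      using x by (simp add: chart_def)
    then have v: "v $ i = 0" and xv: "x = axis i 1 + v"
      by (simp_all add: v_def)
    have Xx: "X i x $ k = a $ k + (A *v v) $ k - l v * v $ k" for k
      unfolding xv by (rule line[OF v])
    have Tx: "T x = a + A *v v + l v *s axis i 1"
      by (simp add: T_def xi v_def)
    have "a $ i + (A *v v) $ i = 0"
      using Xx[of i] hol_vfieldsD(1)[OF X x] v by simp
    then have "T x $ i = l v"
      by (simp add: Tx)
    then show ?thesis
      unfolding T by (simp add: vec_eq_iff Xx Tx) (simp add: xv algebra_simps)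
  qed
  then show thesis
    by (rule that)
qed

section \<open>Fields tangent to a foliation\<close>

lemma subspace_hol_vfields: "vf.subspace (hol_vfields :: 'n::finite vfield set)"
proof (rule vf.subspaceI)
  show "0 \<in> (hol_vfields :: 'n vfield set)"
  proof -
    have "chart_holomorphic i (\<lambda>x. 0)" for i :: 'n
      unfolding chart_holomorphic_def using vec.linear_zero by auto
    moreover have "dir_deriv (chart_change j) x 0 = 0" if "x $ j \<noteq> 0" for j :: 'n and x
      using dir_deriv_chart_change[OF that, of 0] by simp
    ultimately show ?thesis
      unfolding hol_vfields_def by (simp add: zero_fun_def)
  qed
next
  fix X Y :: "'n vfield"
  assume X: "X \<in> hol_vfields" and Y: "Y \<in> hol_vfields"
  have "chart_holomorphic i ((X + Y) i)" for i
    unfolding chart_holomorphic_def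
  proof
    fix x :: "complex ^ 'n"
    assume "x \<in> chart i"
    then obtain D E where "Vector_Spaces.linear (*s) (*s) D" "(X i has_derivative D) (at x within chart i)"
      "Vector_Spaces.linear (*s) (*s) E" "(Y i has_derivative E) (at x within chart i)"
      using hol_vfieldsD(3)[OF X] hol_vfieldsD(3)[OF Y] unfolding chart_holomorphic_def by blast
    then have "Vector_Spaces.linear (*s) (*s) (\<lambda>v. D v + E v)"
      "((\<lambda>x. X i x + Y i x) has_derivative (\<lambda>v. D v + E v)) (at x within chart i)"
      by (auto intro: vec.linear_compose_add has_derivative_add)
    then show "\<exists>D. Vector_Spaces.linear (*s) (*s) D \<and> ((X + Y) i has_derivative D) (at x within chart i)"
      by (auto simp: plus_fun_def)
  qed
  moreover have "(X + Y) j (chart_change j x) = dir_deriv (chart_change j) x ((X + Y) i x)"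
    if x: "x \<in> chart i" "x $ j \<noteq> 0" for i j x
    using vfield_transition[OF X x] vfield_transition[OF Y x]
    unfolding dir_deriv_chart_change[OF x(2)] chart_change_def
    by (simp add: vec_eq_iff add_divide_distrib algebra_simps)
  ultimately show "X + Y \<in> hol_vfields"
    using hol_vfieldsD(1,2)[OF X] hol_vfieldsD(1,2)[OF Y] unfolding hol_vfields_def by simp
next
  fix c and X :: "'n vfield"
  assume X: "X \<in> hol_vfields"
  have "chart_holomorphic i (vf_scale c X i)" for i
    unfolding chart_holomorphic_def
  proof
    fix x :: "complex ^ 'n"
    assume "x \<in> chart i"
    then obtain D where D: "Vector_Spaces.linear (*s) (*s) D" "(X i has_derivative D) (at x within chart i)"
      using hol_vfieldsD(3)[OF X] unfolding chart_holomorphic_def by blast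
    have "linear ((*s) c :: complex ^ 'n \<Rightarrow> complex ^ 'n)"
      by (rule linearI) (simp_all add: vec_eq_iff algebra_simps)
    then have "bounded_linear ((*s) c :: complex ^ 'n \<Rightarrow> complex ^ 'n)"
      by (simp add: linear_conv_bounded_linear)
    then have "((\<lambda>x. c *s X i x) has_derivative (\<lambda>v. c *s D v)) (at x within chart i)"
      by (rule bounded_linear.has_derivative[OF _ D(2)])
    moreover have "Vector_Spaces.linear (*s) (*s) (\<lambda>v. c *s D v)"
      by (rule vec.linear_compose_scale_right[OF D(1)])
    ultimately show "\<exists>D. Vector_Spaces.linear (*s) (*s) D \<and> (vf_scale c X i has_derivative D) (at x within chart i)"
      unfolding vf_scale_def by blast
  qed
  moreover have "vf_scale c X j (chart_change j x) = dir_deriv (chart_change j) x (vf_scale c X i x)"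
    if x: "x \<in> chart i" "x $ j \<noteq> 0" for i j x
    unfolding dir_deriv_chart_change[OF x(2)] chart_change_def vf_scale_def
      vfield_transition[OF X x]
    by (simp add: vec_eq_iff algebra_simps)
  ultimately show "vf_scale c X \<in> hol_vfields"
    using hol_vfieldsD(1,2)[OF X] unfolding hol_vfields_def by (simp add: vf_scale_def)
qed

lemma proper_projective_alg_set_generic:
  fixes S :: "(complex ^ 'n::finite) set"
  assumes "proper_projective_alg_set S"
  obtains s a where "poly_fun s" "s a \<noteq> 0"
    "\<And>z i. s z \<noteq> 0 \<Longrightarrow> z $ i \<noteq> 0 \<Longrightarrow> inverse (z $ i) *s z \<in> chart i - S"
proof -
  have cone: "c *s z \<in> S" if "z \<in> S" "c \<noteq> 0" for c z
    using assms that unfolding proper_projective_alg_set_def by blast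
  obtain a where "a \<notin> S"
    using assms unfolding proper_projective_alg_set_def by blast
  then obtain s where s: "poly_fun s" "\<And>x. x \<in> S \<Longrightarrow> s x = 0" "s a \<noteq> 0"
    using assms algebraic_setE unfolding proper_projective_alg_set_def by metis
  have "inverse (z $ i) *s z \<in> chart i - S" if z: "s z \<noteq> 0" "z $ i \<noteq> 0" for z i
  proof -
    have "z = z $ i *s (inverse (z $ i) *s z)"
      using z(2) by (simp add: vec_eq_iff)
    then have "inverse (z $ i) *s z \<notin> S"
      using cone[OF _ z(2)] s(2) z(1) by metis
    then show ?thesis
      using z(2) by (simp add: chart_def)
  qed
  then show thesis
    using that s by blast
qed

lemma one_form_diff: "one_form A z (u - v) = one_form A z u - one_form A z v"
  and one_form_scale: "one_form A z (c *s v) = c * one_form A z v"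
  by (simp_all add: one_form_def algebra_simps sum_subtractf sum_distrib_left)

text \<open>Passing from the generic points of one chart to all points uses only that the coefficients of the
  form are polynomial and homogeneous, and that the radial field is in its kernel.\<close>

locale homogeneous_form =
  fixes A :: "complex ^ 'n::finite \<Rightarrow> complex ^ 'n" and d :: nat
  assumes poly: "poly_fun (\<lambda>z. A z $ k)"
    and hom: "A (t *s z) = t ^ d *s A z"
    and radial: "one_form A z z = 0"
begin

lemma tangent_linear_field:
  assumes M: "\<And>x. x \<in> chart i \<Longrightarrow> X i x = M *v x - (M *v x) $ i *s x"
    and S: "proper_projective_alg_set S"
    and tangent: "\<And>x. x \<in> chart i \<Longrightarrow> x \<notin> S \<Longrightarrow> one_form A x (X i x) = 0"
  shows "one_form A z (M *v z) = 0"
proof -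
  obtain s a where s: "poly_fun s" "s a \<noteq> 0"
    and generic: "\<And>z i. s z \<noteq> 0 \<Longrightarrow> z $ i \<noteq> 0 \<Longrightarrow> inverse (z $ i) *s z \<in> chart i - S"
    using proper_projective_alg_set_generic[OF S] by metis
  have axis: "(axis i 1 :: complex ^ 'n) $ i \<noteq> 0"
    by simp
  show ?thesis
  proof (rule poly_fun_vanishing_extends2[where g = "\<lambda>z. one_form A z (M *v z)",
        OF _ s poly_fun_coord axis])
    show "poly_fun (\<lambda>z. one_form A z (M *v z))"
      unfolding one_form_def by (intro poly_fun_sum poly_fun_mult poly poly_fun_matrix_vector)
    fix z
    assume z: "s z \<noteq> 0" "z $ i \<noteq> 0"
    define x where "x = inverse (z $ i) *s z"
    have x: "x \<in> chart i" "x \<notin> S"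
      using generic[OF z] by (auto simp: x_def)
    have "0 = one_form A x (M *v x - (M *v x) $ i *s x)"
      using tangent[OF x] M[OF x(1)] by simp
    also have "\<dots> = one_form A x (M *v x)"
      by (simp add: one_form_diff one_form_scale radial)
    also have "\<dots> = inverse (z $ i) ^ d * inverse (z $ i) * one_form A z (M *v z)"
      unfolding x_def vec.linear_scale[OF matrix_vector_mul_linear_gen] one_form_scale
      by (simp add: one_form_def hom sum_distrib_left mult_ac)
    finally show "one_form A z (M *v z) = 0"
      using z(2) by simp
  qed
qed

lemma tangent_algebraI:
  assumes card: "CARD('n) \<ge> 2" and X: "X \<in> hol_vfields" and S: "proper_projective_alg_set S"
    and tangent: "\<And>i x. x \<in> chart i \<Longrightarrow> x \<notin> S \<Longrightarrow> one_form A x (X i x) = 0"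
  shows "X \<in> tangent_algebra A"
proof -
  have "one_form A x (X i x) = 0" if x: "x \<in> chart i" for i x
  proof -
    obtain M where M: "\<And>x. x \<in> chart i \<Longrightarrow> X i x = M *v x - (M *v x) $ i *s x"
      using vfield_linear[OF X card] by blast
    show ?thesis
      using tangent_linear_field[where X = X and i = i and S = S, OF M S tangent] M[OF x] radial
      by (simp add: one_form_diff one_form_scale)
  qed
  then show ?thesis
    using X hol_vfieldsD(1)[OF X] unfolding tangent_algebra_def leaf_tangent_def by blast
qed

lemma proper_projective_alg_set_zeros:
  assumes "A a \<noteq> 0"
  shows "proper_projective_alg_set {z. A z = 0}"
proof -
  have "algebraic_set {z. A z = 0}"
    unfolding algebraic_set_def
    by (rule exI[of _ "{\<lambda>z. A z $ k | k. True}"]) (auto simp: poly vec_eq_iff)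
  then show ?thesis
    using assms unfolding proper_projective_alg_set_def by (auto simp: hom)
qed

end

text \<open>In the chart \<open>j\<close> the field is zero at \<open>z\<close> exactly when \<open>M z\<close> is proportional to \<open>z\<close>, that is,
  when the polynomials \<open>z\<^sub>j (M z)\<^sub>k - (M z)\<^sub>j z\<^sub>k\<close> vanish.  They vanish at generic points by transition
  from the chart \<open>i\<close>.\<close>

lemma hol_vfield_zeroI:
  fixes X :: "'n::finite vfield"
  assumes card: "CARD('n) \<ge> 2" and X: "X \<in> hol_vfields" and S: "proper_projective_alg_set S"
    and zero: "\<And>x. x \<in> chart i \<Longrightarrow> x \<notin> S \<Longrightarrow> X i x = 0"
  shows "X = 0"
proof -
  have on_chart: "X j x = 0" if x: "x \<in> chart j" for j x
  proof -
    obtain M where M: "\<And>x. x \<in> chart j \<Longrightarrow> X j x = M *v x - (M *v x) $ j *s x"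
      using vfield_linear[OF X card] by blast
    obtain s a where s: "poly_fun s" "s a \<noteq> 0"
      and generic: "\<And>z i. s z \<noteq> 0 \<Longrightarrow> z $ i \<noteq> 0 \<Longrightarrow> inverse (z $ i) *s z \<in> chart i - S"
      using proper_projective_alg_set_generic[OF S] by metis
    have one: "((\<chi> k. 1) :: complex ^ 'n) $ i * ((\<chi> k. 1) :: complex ^ 'n) $ j \<noteq> 0"
      by simp
    have minor: "z $ j * (M *v z) $ k - (M *v z) $ j * z $ k = 0" for z k
    proof (rule poly_fun_vanishing_extends2[where g = "\<lambda>z. z $ j * (M *v z) $ k - (M *v z) $ j * z $ k",
          OF _ s poly_fun_mult[OF poly_fun_coord[of i] poly_fun_coord[of j]] one])
      show "poly_fun (\<lambda>z. z $ j * (M *v z) $ k - (M *v z) $ j * z $ k)"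
        by (intro poly_fun_diff poly_fun_mult poly_fun_coord poly_fun_matrix_vector)
      fix z :: "complex ^ 'n"
      assume sz: "s z \<noteq> 0" and "z $ i * z $ j \<noteq> 0"
      then have z: "z $ i \<noteq> 0" "z $ j \<noteq> 0"
        by auto
      let ?x = "inverse (z $ i) *s z" and ?y = "inverse (z $ j) *s z"
      have x: "?x \<in> chart i" "?x \<notin> S" "?x $ j \<noteq> 0"
        using generic[OF sz z(1)] z by auto
      have xy: "inverse (?x $ j) *s ?x = ?y"
        using z by (simp add: vec_eq_iff)
      have "X j ?y = 0"
        using vfield_transition[OF X x(1,3)] unfolding xy zero[OF x(1,2)] by simp
      moreover have "?y \<in> chart j"
        using z by (simp add: chart_def)
      ultimately have "(M *v ?y) $ k - (M *v ?y) $ j * ?y $ k = 0"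
        using M[of ?y] by (metis vector_minus_component vector_smult_component zero_index)
      then show "z $ j * (M *v z) $ k - (M *v z) $ j * z $ k = 0"
        unfolding vec.linear_scale[OF matrix_vector_mul_linear_gen]
        using z by (simp add: field_simps)
    qed
    have "x $ j = 1"
      using x by (simp add: chart_def)
    then have "(M *v x) $ k - (M *v x) $ j * x $ k = 0" for k
      using minor[of x k] by simp
    then show ?thesis
      unfolding M[OF x] vec_eq_iff vector_minus_component vector_smult_component zero_index
      by blast
  qed
  have "X j x = 0" for j x
    using on_chart[of x j] hol_vfieldsD(2)[OF X, of x j] by blast
  then show ?thesis
    by (simp add: fun_eq_iff)
qed

section \<open>The determinant of a family of tangent fields\<close>

text \<open>The \<open>n + 1\<close> rows are \<open>z\<close> at the index \<open>i\<close>, a free vector at the index \<open>j\<close>, and the values at \<open>z\<close> of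
  \<open>n - 1\<close> linear fields, which are indexed by the remaining coordinates.\<close>

definition frame :: "'n \<Rightarrow> 'n \<Rightarrow> ('n \<Rightarrow> complex ^ 'n ^ 'n) \<Rightarrow> complex ^ 'n::finite \<Rightarrow> complex ^ 'n \<Rightarrow> complex ^ 'n ^ 'n" where
  "frame i j M z v = (\<chi> r. if r = j then v else if r = i then z else M r *v z)"

text \<open>The coefficient vector of the \<open>1\<close>-form obtained by contracting the volume form with the radial
  field and the fields \<open>M k\<close>.\<close>

definition frame_form :: "'n \<Rightarrow> 'n \<Rightarrow> ('n \<Rightarrow> complex ^ 'n ^ 'n) \<Rightarrow> complex ^ 'n::finite \<Rightarrow> complex ^ 'n" where
  "frame_form i j M z = (\<chi> m. det (frame i j M z (axis m 1)))"

lemma poly_fun_frame_form: "poly_fun (\<lambda>z. frame_form i j M z $ m)"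
proof -
  have "poly_fun (\<lambda>z. frame i j M z (axis m 1) $ r $ s)" for r s
    by (cases "r = j"; cases "r = i") (simp_all add: frame_def poly_fun_matrix_vector)
  then show ?thesis
    by (simp add: frame_form_def poly_fun_det)
qed

lemma frame_form_homogeneous:
  fixes z :: "complex ^ 'n::finite"
  shows "frame_form i j M (t *s z) = t ^ (CARD('n) - 1) *s frame_form i j M z"
proof -
  have "det (frame i j M (t *s z) v) = t ^ (CARD('n) - 1) * det (frame i j M z v)" for v
  proof -
    let ?c = "\<lambda>r. if r = j then 1 else t"
    have "frame i j M (t *s z) v = (\<chi> r. ?c r *s (frame i j M z v $ r))"
      by (rule vec_eq_iff[THEN iffD2])
        (simp add: frame_def vec.linear_scale[OF matrix_vector_mul_linear_gen])
    then have "det (frame i j M (t *s z) v) = prod ?c UNIV * det (\<chi> r. frame i j M z v $ r)"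
      by (simp only: det_rows_mul)
    also have "prod ?c UNIV = prod ?c (UNIV - {j})"
      by (rule prod.mono_neutral_right) auto
    also have "\<dots> = t ^ (CARD('n) - 1)"
      by (simp add: card_Diff_singleton)
    finally show ?thesis
      by simp
  qed
  then show ?thesis
    by (simp add: frame_form_def vec_eq_iff)
qed

text \<open>All rows lie in the kernel of the nonzero functional \<open>one_form A z\<close>.\<close>

lemma det_frame_tangent:
  assumes A: "A z \<noteq> 0" and radial: "one_form A z z = 0"
    and M: "\<And>k. k \<noteq> i \<Longrightarrow> k \<noteq> j \<Longrightarrow> one_form A z (M k *v z) = 0" and v: "one_form A z v = 0"
  shows "det (frame i j M z v) = 0"
proof -
  have "(frame i j M z v *v A z) $ r = one_form A z (frame i j M z v $ r)" for r
    by (simp add: matrix_vector_mult_def one_form_def mult.commute)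
  moreover have "one_form A z (frame i j M z v $ r) = 0" for r
    using M v radial by (simp add: frame_def)
  ultimately have "frame i j M z v *v A z = 0"
    by (simp add: vec_eq_iff)
  then show ?thesis
    using A by (metis invertible_det_nz invertible_left_inverse matrix_left_invertible_ker)
qed

text \<open>A form that vanishes on the kernel of another one is proportional to it.\<close>

lemma frame_form_proportional:
  assumes radial: "one_form A z z = 0"
    and M: "\<And>k. k \<noteq> i \<Longrightarrow> k \<noteq> j \<Longrightarrow> one_form A z (M k *v z) = 0"
  shows "frame_form i j M z $ l * A z $ k = frame_form i j M z $ k * A z $ l"
proof (cases "A z = 0")
  case False
  let ?b = "\<lambda>r. if r = i then z else M r *v z"
  let ?v = "A z $ k *s axis l 1 + (- A z $ l) *s axis k 1"
  have "one_form A z (axis l 1) = A z $ l" for l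
    by (simp add: one_form_def axis_def if_distrib cong: if_cong)
  then have "one_form A z ?v = 0"
    by (simp add: one_form_diff one_form_scale)
  then have "0 = det (frame i j M z ?v)"
    using det_frame_tangent[OF False radial M] by simp
  also have "\<dots> = A z $ k * det (frame i j M z (axis l 1)) + (- A z $ l) * det (frame i j M z (axis k 1))"
    unfolding frame_def det_row_add[of j "\<lambda>_. A z $ k *s axis l 1" "\<lambda>_. (- A z $ l) *s axis k 1" ?b]
      det_row_mul[of j _ "\<lambda>_. axis _ 1" ?b] ..
  finally show ?thesis
    by (simp add: frame_form_def mult.commute)
qed simp

text \<open>A vector in the kernel has coordinate \<open>0\<close> at \<open>j\<close> and is orthogonal to \<open>x\<close>, by the rows \<open>j\<close> and
  \<open>i\<close>; the other rows then remove all coordinates but the one at \<open>i\<close>, and orthogonality to \<open>x\<close>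
  removes that one.\<close>

lemma det_frame_nonzero:
  fixes x :: "complex ^ 'n::finite"
  assumes ij: "i \<noteq> j" and xi: "x $ i = 1"
    and M: "\<And>k. k \<noteq> i \<Longrightarrow> k \<noteq> j \<Longrightarrow> M k *v x = axis k 1 - a k *s axis j 1 + b k *s x"
  shows "det (frame i j M x (axis j 1)) \<noteq> 0"
proof -
  let ?B = "frame i j M x (axis j 1)"
  have "u = 0" if u: "?B *v u = 0" for u
  proof -
    have row: "(\<Sum>s\<in>UNIV. ?B $ r $ s * u $ s) = 0" for r
      using u by (simp add: vec_eq_iff matrix_vector_mult_def)
    have axis_u: "(\<Sum>s\<in>UNIV. (axis l 1 :: complex ^ 'n) $ s * u $ s) = u $ l" for l
      by (simp add: axis_def if_distrib[of "\<lambda>c. c * _"] cong: if_cong)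
    have uj: "u $ j = 0"
      using row[of j] axis_u[of j] by (simp add: frame_def)
    have xu: "(\<Sum>s\<in>UNIV. x $ s * u $ s) = 0"
      using row[of i] ij by (simp add: frame_def)
    have uk: "u $ k = 0" if k: "k \<noteq> i" "k \<noteq> j" for k
    proof -
      have "0 = (\<Sum>s\<in>UNIV. (M k *v x) $ s * u $ s)"
        using row[of k] k by (simp add: frame_def)
      also have "\<dots> = (\<Sum>s\<in>UNIV. axis k 1 $ s * u $ s) - a k * (\<Sum>s\<in>UNIV. axis j 1 $ s * u $ s)
          + b k * (\<Sum>s\<in>UNIV. x $ s * u $ s)"
        unfolding M[OF k] by (simp add: algebra_simps sum.distrib sum_subtractf sum_distrib_left)
      also have "\<dots> = u $ k"
        unfolding axis_u xu uj by simp
      finally show ?thesis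
        by simp
    qed
    have "x $ s * u $ s = (if s = i then u $ s else 0)" for s
      using uj uk[of s] xi by (cases "s = j") auto
    then have "u $ i = 0"
      using xu by simp
    then show "u = 0"
      using uj uk by (metis vec_eq_iff zero_index)
  qed
  then show ?thesis
    by (metis invertible_det_nz invertible_left_inverse matrix_left_invertible_ker)
qed

text \<open>Cramer's rule for the expansion of \<open>N z\<close> in the rows of the frame.\<close>

lemma frame_expansion:
  assumes nz: "det (frame i j M z v) \<noteq> 0"
  shows "\<exists>g. N *v z = (\<Sum>r\<in>UNIV. g r *s (frame i j M z v $ r)) \<and>
    (\<forall>k. k \<noteq> i \<and> k \<noteq> j \<longrightarrow>
       det (frame i j (M(k := N)) z v) = g k * det (frame i j M z v)) \<and>
    det (frame i j M z (N *v z)) = g j * det (frame i j M z v)"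
proof -
  let ?B = "frame i j M z v"
  obtain C where C: "C ** ?B = mat 1"
    using nz invertible_det_nz invertible_left_inverse by metis
  define x where "x = (N *v z) v* C"
  have "x v* ?B = N *v z"
    by (simp add: x_def vector_matrix_mul_assoc C)
  moreover have "x v* ?B = (\<Sum>r\<in>UNIV. x $ r *s (?B $ r))"
    by (simp add: vec_eq_iff vector_matrix_mult_def sum_component mult.commute)
  ultimately have Nz: "N *v z = (\<Sum>r\<in>UNIV. x $ r *s (?B $ r))"
    by simp
  have row: "row r ?B = ?B $ r" for r
    by (simp add: row_def vec_eq_iff)
  have cramer: "det (\<chi> r. if r = k then N *v z else ?B $ r) = x $ k * det ?B" for k
    using cramer_lemma_transpose[where A = ?B and x = x and k = k] unfolding row Nz .
  have 1: "det (frame i j (M(k := N)) z v) = x $ k * det ?B" if "k \<noteq> i" "k \<noteq> j" for k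
  proof -
    have "frame i j (M(k := N)) z v = (\<chi> r. if r = k then N *v z else ?B $ r)"
      using that by (auto simp: vec_eq_iff frame_def)
    then show ?thesis
      by (simp only: cramer)
  qed
  have "frame i j M z (N *v z) = (\<chi> r. if r = j then N *v z else ?B $ r)"
    by (auto simp: vec_eq_iff frame_def)
  then have 2: "det (frame i j M z (N *v z)) = x $ j * det ?B"
    by (simp only: cramer)
  show ?thesis
    by (rule exI[of _ "\<lambda>r. x $ r"]) (use Nz 1 2 in blast)
qed

section \<open>The degree and the dimension of the algebra\<close>

lemma sum_vf_scale_apply: "(\<Sum>k\<in>K. vf_scale (c k) (X k)) i x = (\<Sum>k\<in>K. c k *s X k i x)"
  by (induction K rule: infinite_finite_induct) (simp_all add: vf_scale_def)

lemma independent_vfieldsI: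
  fixes X :: "'n::finite \<Rightarrow> 'n vfield"
  assumes dual: "\<And>k l. k \<in> K \<Longrightarrow> l \<in> K \<Longrightarrow> X k i x $ l = (if k = l then 1 else 0)"
  shows "inj_on X K" "vf.independent (X ` K)"
proof -
  show inj: "inj_on X K"
  proof (rule inj_onI)
    fix k l
    assume kl: "k \<in> K" "l \<in> K" "X k = X l"
    then have "X k i x $ l = X l i x $ l"
      by simp
    then show "k = l"
      using dual[of k l] dual[of l l] kl by (simp split: if_splits)
  qed
  have "c (X l) = 0" if zero: "(\<Sum>Y\<in>X ` K. vf_scale (c Y) Y) = 0" and l: "l \<in> K" for c l
  proof -
    have "(\<Sum>k\<in>K. vf_scale (c (X k)) (X k)) = 0"
      using zero inj by (simp add: sum.reindex)
    then have "(\<Sum>k\<in>K. c (X k) *s X k i x) = 0"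
      using sum_vf_scale_apply[of "\<lambda>k. c (X k)" X K i x] by simp
    then have "(\<Sum>k\<in>K. c (X k) * X k i x $ l) = 0"
      by (metis (mono_tags, lifting) sum.cong sum_component vector_smult_component zero_index)
    also have "(\<Sum>k\<in>K. c (X k) * X k i x $ l) = (\<Sum>k\<in>K. if k = l then c (X k) else 0)"
      by (rule sum.cong) (simp_all add: dual l)
    also have "\<dots> = c (X l)"
      using l by (simp add: sum.delta')
    finally show ?thesis .
  qed
  then show "vf.independent (X ` K)"
    by (subst vf.dependent_finite) auto
qed

theorem proposition1p4:
  fixes A :: "complex ^ 'n::finite \<Rightarrow> complex ^ 'n" and n \<nu> :: nat
  assumes "CARD('n) = n + 1"
    and "codim1_foliation \<nu> A"
    and "L_foliation A"
  shows "int \<nu> \<le> int n - 1 \<and>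
    (int \<nu> = int n - 1 \<longrightarrow> int (vf.dim (tangent_algebra A)) = int n - 1)"
proof -
  have hp: "hom_poly_fun (\<nu> + 1) (\<lambda>z. A z $ k)" and rad: "(\<Sum>k\<in>UNIV. z $ k * A z $ k) = 0"
    and codim: "codim {z. \<forall>k. A z $ k = 0} \<ge> 2" for k z
    using assms(2) unfolding codim1_foliation_def by blast+
  interpret homogeneous_form A "\<nu> + 1"
  proof
    show "poly_fun (\<lambda>z. A z $ k)" for k
      by (rule hom_poly_fun_imp_poly_fun[OF hp])
    show "A (t *s z) = t ^ (\<nu> + 1) *s A z" for t z
      unfolding vec_eq_iff vector_smult_component using hom_poly_fun_scale[OF hp] by blast
    show "one_form A z z = 0" for z
      using rad[of z] by (simp add: one_form_def mult.commute)
  qed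
  obtain L S where L: "lie_subalgebra L" and S: "proper_projective_alg_set S"
    and gen: "\<And>i x. x \<in> chart i \<Longrightarrow> x \<notin> S \<Longrightarrow> A x \<noteq> 0 \<and> {X i x | X. X \<in> L} = leaf_tangent A i x"
    using assms(3) unfolding L_foliation_def by blast
  have L_hol: "X \<in> hol_vfields" if "X \<in> L" for X
    using L that unfolding lie_subalgebra_def by blast
  define i :: 'n where "i = undefined"
  obtain x where x: "x \<in> chart i" "x \<notin> S"
  proof -
    obtain s a where s: "poly_fun s" "s a \<noteq> 0"
      "\<And>z i. s z \<noteq> 0 \<Longrightarrow> z $ i \<noteq> 0 \<Longrightarrow> inverse (z $ i) *s z \<in> chart i - S"
      using proper_projective_alg_set_generic[OF S] by metis
    have "(axis i 1 :: complex ^ 'n) $ i \<noteq> 0"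
      by simp
    then obtain z where "s z \<noteq> 0" "z $ i \<noteq> 0"
      using poly_fun_integral_domain[OF s(1) poly_fun_coord s(2)] by metis
    then show thesis
      using s(3) that by blast
  qed
  have xi: "x $ i = 1"
    using x by (simp add: chart_def)
  have Ax: "A x \<noteq> 0" and leaf: "{X i x | X. X \<in> L} = leaf_tangent A i x"
    using gen[OF x] by auto
  obtain j where j: "j \<noteq> i" "A x $ j \<noteq> 0"
  proof (rule ccontr)
    assume neg: "\<not> thesis"
    have "A x $ k * x $ k = (if k = i then A x $ k else 0)" for k
      using neg that xi by (cases "k = i") auto
    then have "A x $ i = 0"
      using radial[of x] by (simp add: one_form_def)
    then have "A x = 0"
      using neg that by (metis vec_eq_iff zero_index)
    with Ax show False ..
  qed
  have "card {i, j} \<le> CARD('n)"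
    by (rule card_mono) auto
  then have card: "CARD('n) \<ge> 2"
    using j by simp
  define K where "K = UNIV - {i, j}"
  have K: "k \<in> K \<longleftrightarrow> k \<noteq> i \<and> k \<noteq> j" for k
    by (auto simp: K_def)
  have cardK: "card K = n - 1"
    using assms(1) j by (simp add: K_def card_Diff_subset)
  have A_axis: "one_form A z (axis l 1) = A z $ l" for z l
    by (simp add: one_form_def axis_def if_distrib cong: if_cong)
  \<comment> \<open>The basis of the leaf tangent space at \<open>x\<close> that makes it a graph over the coordinates in \<open>K\<close>.\<close>
  define v where "v k = axis k 1 - (A x $ k / A x $ j) *s axis j 1" for k
  have exX: "\<forall>k\<in>K. \<exists>X. X \<in> L \<and> X i x = v k"
  proof
    fix k
    assume k: "k \<in> K"
    have "v k $ i = 0"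
      using k j by (auto simp: v_def K axis_def)
    moreover have "one_form A x (v k) = 0"
      using j by (simp add: v_def one_form_diff one_form_scale A_axis)
    ultimately have "v k \<in> leaf_tangent A i x"
      by (simp add: leaf_tangent_def)
    then have "v k \<in> {X i x | X. X \<in> L}"
      by (simp only: leaf)
    then show "\<exists>X. X \<in> L \<and> X i x = v k"
      by (simp add: eq_commute conj_commute)
  qed
  obtain X where X: "\<forall>k\<in>K. X k \<in> L \<and> X k i x = v k"
    using bchoice[OF exX] ..
  have XL: "X k \<in> L" and Xx: "X k i x = v k" if "k \<in> K" for k
    using X that by simp_all
  have tangent: "one_form A y (Y l y) = 0" if "Y \<in> L" "y \<in> chart l" "y \<notin> S" for Y l y
  proof -
    have "Y l y \<in> {X l y | X. X \<in> L}"
      by (intro CollectI exI[of _ Y] conjI refl that(1))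
    also have "\<dots> = leaf_tangent A l y"
      using gen[OF that(2,3)] by (rule conjunct2)
    finally show ?thesis
      by (simp add: leaf_tangent_def)
  qed
  have exM: "\<forall>k\<in>K. \<exists>N. \<forall>y\<in>chart i. X k i y = N *v y - (N *v y) $ i *s y"
  proof
    fix k
    assume "k \<in> K"
    then have "X k \<in> hol_vfields"
      by (intro L_hol XL)
    then show "\<exists>N. \<forall>y\<in>chart i. X k i y = N *v y - (N *v y) $ i *s y"
      using vfield_linear[OF _ card] by metis
  qed
  obtain M where "\<forall>k\<in>K. \<forall>y\<in>chart i. X k i y = M k *v y - (M k *v y) $ i *s y"
    using bchoice[OF exM] ..
  then have M: "X k i y = M k *v y - (M k *v y) $ i *s y" if "k \<in> K" "y \<in> chart i" for k y
    using that by blast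
  have AM: "one_form A z (M k *v z) = 0" if "k \<in> K" for k z
    by (rule tangent_linear_field[where X = "X k" and i = i and S = S,
          OF M[OF that] S tangent[OF XL[OF that]]])
  define H where "H = frame_form i j M"
  have n: "CARD('n) - 1 = n"
    using assms(1) by simp
  have minors: "frame_form i j N z $ l * A z $ k = frame_form i j N z $ k * A z $ l"
    if "\<And>k. k \<in> K \<Longrightarrow> one_form A z (N k *v z) = 0" for N z k l
    by (rule frame_form_proportional[OF radial]) (use that K in blast)
  have frame_hom: "frame_form i j N (t *s z) = t ^ n *s frame_form i j N z" for N t z
    using frame_form_homogeneous[of i j N t z] n by simp
  have degree_bound: "\<nu> + 1 \<le> n"
    if N: "\<And>k z. k \<in> K \<Longrightarrow> one_form A z (N k *v z) = 0" and nz: "frame_form i j N y \<noteq> 0" for N y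
    by (rule proportional_homogeneous(1)[where H = "frame_form i j N", OF poly hom codim Ax
          poly_fun_frame_form frame_hom _ nz]) (rule minors[OF N])
  have multiple: "\<exists>c. \<forall>z. frame_form i j N z = c *s A z"
    if N: "\<And>k z. k \<in> K \<Longrightarrow> one_form A z (N k *v z) = 0" and \<nu>: "n = \<nu> + 1" for N
    by (rule proportional_homogeneous(2)[where H = "frame_form i j N", OF poly hom codim Ax
          poly_fun_frame_form frame_hom _ \<nu>]) (rule minors[OF N])
  have "det (frame i j M x (axis j 1)) \<noteq> 0"
  proof (rule det_frame_nonzero[OF j(1)[symmetric] xi])
    fix k
    assume "k \<noteq> i" "k \<noteq> j"
    then have k: "k \<in> K"
      by (simp add: K)
    show "M k *v x = axis k 1 - (A x $ k / A x $ j) *s axis j 1 + (M k *v x) $ i *s x"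
      using M[OF k x(1)] unfolding Xx[OF k] v_def by simp
  qed
  then have "H x $ j \<noteq> 0"
    by (simp add: H_def frame_form_def)
  then have "H x \<noteq> 0"
    by auto
  then have deg: "\<nu> + 1 \<le> n"
    using degree_bound[of M x] AM unfolding H_def by blast
  moreover have "vf.dim (tangent_algebra A) = n - 1" if \<nu>: "\<nu> + 1 = n"
  proof (rule vf.dim_unique)
    have dual: "X k i x $ l = (if k = l then 1 else 0)" if "k \<in> K" "l \<in> K" for k l
      unfolding Xx[OF that(1)] using that by (auto simp: v_def K axis_def)
    show "vf.independent (X ` K)"
      by (rule independent_vfieldsI(2)[of K X i x]) (rule dual)
    show "card (X ` K) = n - 1"
    proof -
      have "inj_on X K"
        by (rule independent_vfieldsI(1)[of K X i x]) (rule dual)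
      then show ?thesis
        using cardK by (simp add: card_image)
    qed
    show "X ` K \<subseteq> tangent_algebra A"
    proof (rule image_subsetI)
      fix k
      assume "k \<in> K"
      note Xk = XL[OF this]
      show "X k \<in> tangent_algebra A"
        by (rule tangent_algebraI[OF card L_hol[OF Xk] S tangent[OF Xk]])
    qed
    obtain c where c: "\<And>z. H z = c *s A z"
      using multiple[of M] AM \<nu> unfolding H_def by metis
    have c0: "c \<noteq> 0"
      using \<open>H x \<noteq> 0\<close> c[of x] by auto
    show "tangent_algebra A \<subseteq> vf.span (X ` K)"
    proof
      fix Y
      assume "Y \<in> tangent_algebra A"
      then have Y: "Y \<in> hol_vfields" and Yt: "\<And>y. y \<in> chart i \<Longrightarrow> A y \<noteq> 0 \<Longrightarrow> one_form A y (Y i y) = 0"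
        unfolding tangent_algebra_def leaf_tangent_def by blast+
      note sing = proper_projective_alg_set_zeros[OF Ax]
      obtain N where N: "\<And>y. y \<in> chart i \<Longrightarrow> Y i y = N *v y - (N *v y) $ i *s y"
        using vfield_linear[OF Y card] by blast
      have AN: "one_form A z (N *v z) = 0" for z
        by (rule tangent_linear_field[where X = Y and i = i, OF N sing]) (use Yt in auto)
      \<comment> \<open>The determinants with \<open>N\<close> in place of one \<open>M k\<close> are the numerators in Cramer's rule.\<close>
      have exb: "\<forall>k. \<exists>b. \<forall>z. frame_form i j (M(k := N)) z = b *s A z"
      proof
        fix k
        have "one_form A z ((M(k := N)) l *v z) = 0" if "l \<in> K" for l z
          using AM[OF that] AN by simp
        then show "\<exists>b. \<forall>z. frame_form i j (M(k := N)) z = b *s A z"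
          by (rule multiple) (use \<nu> in simp_all)
      qed
      obtain b where b: "\<forall>k z. frame_form i j (M(k := N)) z = b k *s A z"
        using choice[OF exb] ..
      define g where "g k = b k / c" for k
      define Z where "Z = Y - (\<Sum>k\<in>K. vf_scale (g k) (X k))"
      have "(\<Sum>k\<in>K. vf_scale (g k) (X k)) \<in> hol_vfields"
        by (intro vf.subspace_sum[OF subspace_hol_vfields] vf.subspace_scale[OF subspace_hol_vfields] L_hol XL)
      then have "Z \<in> hol_vfields"
        unfolding Z_def by (intro vf.subspace_diff[OF subspace_hol_vfields] Y)
      moreover have "Z i y = 0" if y: "y \<in> chart i" "y \<notin> {z. A z = 0}" for y
      proof -
        obtain m where m: "A y $ m \<noteq> 0"
          using y(2) by (auto simp: vec_eq_iff)
        have det: "det (frame i j M y (axis m 1)) = c * A y $ m"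
          using c[of y] by (simp add: H_def frame_form_def vec_eq_iff)
        then have detnz: "det (frame i j M y (axis m 1)) \<noteq> 0"
          using c0 m by simp
        obtain h where h: "N *v y = (\<Sum>r\<in>UNIV. h r *s (frame i j M y (axis m 1) $ r))"
          and hk: "\<forall>k. k \<noteq> i \<and> k \<noteq> j \<longrightarrow>
            det (frame i j (M(k := N)) y (axis m 1)) = h k * det (frame i j M y (axis m 1))"
          and hj: "det (frame i j M y (N *v y)) = h j * det (frame i j M y (axis m 1))"
          using frame_expansion[OF detnz, of N] by (elim exE conjE)
        have "h j = 0"
        proof -
          have "det (frame i j M y (N *v y)) = 0"
            by (rule det_frame_tangent[OF _ radial _ AN]) (use y(2) AM K in auto)
          then show ?thesis
            using hj det c0 m by simp
        qed
        have hg: "h k = g k" if "k \<in> K" for k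
        proof -
          have "b k * A y $ m = h k * (c * A y $ m)"
            using that hk[rule_format, of k] b[rule_format, of k y] by (simp add: K det frame_form_def vec_eq_iff)
          then show ?thesis
            using m c0 by (simp add: g_def field_simps)
        qed
        have "N *v y = (\<Sum>r\<in>insert i (insert j K). h r *s (frame i j M y (axis m 1) $ r))"
          unfolding h by (rule sum.cong) (auto simp: K_def)
        also have "\<dots> = h i *s y + (\<Sum>k\<in>K. h k *s (frame i j M y (axis m 1) $ k))"
          using j \<open>h j = 0\<close> by (simp add: K frame_def)
        also have "(\<Sum>k\<in>K. h k *s (frame i j M y (axis m 1) $ k)) = (\<Sum>k\<in>K. g k *s (M k *v y))"
          by (rule sum.cong) (simp_all add: hg K frame_def)
        finally have Ny: "N *v y = h i *s y + (\<Sum>k\<in>K. g k *s (M k *v y))" .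
        have "(\<Sum>k\<in>K. vf_scale (g k) (X k)) i y = (\<Sum>k\<in>K. g k *s (M k *v y - (M k *v y) $ i *s y))"
          unfolding sum_vf_scale_apply by (rule sum.cong) (simp_all add: M y)
        also have "\<dots> = (\<Sum>k\<in>K. g k *s (M k *v y)) - (\<Sum>k\<in>K. g k *s (M k *v y)) $ i *s y"
          by (simp add: vec_eq_iff sum_component sum_subtractf right_diff_distrib
              sum_distrib_left sum_distrib_right mult_ac)
        also have "\<dots> = Y i y"
        proof -
          have "w - w $ i *s y = (a *s y + w) - (a *s y + w) $ i *s y" for w a
            using y(1) by (simp add: vec_eq_iff chart_def algebra_simps)
          then show ?thesis
            unfolding N[OF y(1)] Ny .
        qed
        finally show ?thesis
          by (simp add: Z_def)
      qed
      ultimately have "Z = 0"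
        by (rule hol_vfield_zeroI[OF card _ sing])
      then have "Y = (\<Sum>k\<in>K. vf_scale (g k) (X k))"
        by (simp add: Z_def)
      then show "Y \<in> vf.span (X ` K)"
        by (simp add: vf.span_sum vf.span_scale vf.span_base)
    qed
  qed
  ultimately show ?thesis
    by auto
qed

end
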